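(* Let $S^{\mathrm{gr}}_n$ be the final score of player $\mathsf N$ in semi-restricted Rock, Paper, Scissors played over $3n$ rounds when both players use their greedy strategies. Then, as $n\to\infty$, $$\operatorname{Var} S^{\mathrm{gr}}_n \sim \Bigl(4-\frac{27-6\sqrt3}{4\pi}\Bigr)\,n .$$
   Context: Semi-restricted Rock, Paper, Scissors over $3n$ rounds: there are two players, $\mathsf R$ (restricted) and $\mathsf N$ (normal), and three moves rock, paper, scissors, numbered $1,2,3$, where move $i+1$ beats move $i$ (indices mod 3). In each of $3n$ rounds both players simultaneously choose a move, knowing all moves made in earlier rounds; choices may be randomized (and, given the history, the two players' choices in a round are independent). $\mathsf R$ must choose each of the three moves exactly $n$ times during the $3n$ rounds; $\mathsf N$ is unrestricted. A round in which both select the same move is a draw. The final score of $\mathsf N$ is the number of rounds won by $\mathsf N$ minus the number of rounds won by $\mathsf R$. Greedy strategies (in each round, each player plays the optimal strategy for the expected score of that single round, with fresh independent randomness, given which moves $\mathsf R$ still has available): - If $\mathsf R$ still has all three moves available, each player chooses each of the three moves with probability $1/3$. - If $\mathsf R$ has exactly two moves available, say $i$ and $i+1$ (mod 3), then $\mathsf R$ plays $i$ with probability $1/3$ and $i+1$ with probability $2/3$, and $\mathsf N$ plays $i+1$ with probability $2/3$ and $i+2$ with probability $1/3$. - If $\mathsf R$ has only one move $i$ available, $\mathsf R$ plays $i$ and $\mathsf N$ plays $i+1$. $a_n\sim b_n$ means $a_n/b_n\to1$. *)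

theory Defs
  imports "HOL-Probability.Probability" "HOL-Library.Landau_Symbols"
begin

text \<open>
  The three moves, numbered 1, 2, 3 in the order of declaration; \<open>succ3 i\<close> is the move
  \<open>i + 1\<close> with indices taken modulo 3, that is, the move that beats \<open>i\<close>.
\<close>

datatype move = Rock | Paper | Scissors

fun succ3 :: "move \<Rightarrow> move" where
  "succ3 Rock = Paper"
| "succ3 Paper = Scissors"
| "succ3 Scissors = Rock"

lemma UNIV_move: "(UNIV :: move set) = {Rock, Paper, Scissors}"
  using move.exhaust by auto

instance move :: finite
  by standard (simp add: UNIV_move)

definition beats :: "move \<Rightarrow> move \<Rightarrow> bool" where
  "beats a b \<longleftrightarrow> a = succ3 b"

text \<open>
  A history lists the completed rounds in chronological order, each as a pair of the move of the
  restricted player R and the move of the normal player N.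
\<close>

type_synonym history = "(move \<times> move) list"

type_synonym strategy = "history \<Rightarrow> move pmf"

text \<open>
  \<open>pair_pmf\<close> makes the two choices in a round independent given the history.
\<close>

primrec play :: "strategy \<Rightarrow> strategy \<Rightarrow> nat \<Rightarrow> history pmf" where
  "play \<rho> \<nu> 0 = return_pmf []"
| "play \<rho> \<nu> (Suc k) =
     bind_pmf (play \<rho> \<nu> k) (\<lambda>h. map_pmf (\<lambda>m. h @ [m]) (pair_pmf (\<rho> h) (\<nu> h)))"

definition score :: "history \<Rightarrow> int" where
  "score h = int (length (filter (\<lambda>(r, s). beats s r) h))
           - int (length (filter (\<lambda>(r, s). beats r s) h))"

definition available :: "nat \<Rightarrow> history \<Rightarrow> move set" where
  "available n h = {i. count_list (map fst h) i < n}"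

text \<open>
  Every two-element set of moves is \<open>{i, succ3 i}\<close> for a unique \<open>i\<close>. The values for the
  empty set are irrelevant: during the first \<open>3 * n\<close> rounds some move is available.
\<close>

definition greedy_R_move :: "move set \<Rightarrow> move pmf" where
  "greedy_R_move A =
     (if card A = 3 then pmf_of_set UNIV
      else if card A = 2 then
        (let i = (THE i. A = {i, succ3 i})
         in map_pmf (\<lambda>b. if b then i else succ3 i) (bernoulli_pmf (1/3)))
      else return_pmf (THE i. A = {i}))"

definition greedy_N_move :: "move set \<Rightarrow> move pmf" where
  "greedy_N_move A =
     (if card A = 3 then pmf_of_set UNIV
      else if card A = 2 then
        (let i = (THE i. A = {i, succ3 i})
         in map_pmf (\<lambda>b. if b then succ3 i else succ3 (succ3 i)) (bernoulli_pmf (2/3)))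
      else return_pmf (succ3 (THE i. A = {i})))"

definition greedy_R :: "nat \<Rightarrow> strategy" where
  "greedy_R n h = greedy_R_move (available n h)"

definition greedy_N :: "nat \<Rightarrow> strategy" where
  "greedy_N n h = greedy_N_move (available n h)"

definition greedy_game :: "nat \<Rightarrow> history pmf" where
  "greedy_game n = play (greedy_R n) (greedy_N n) (3 * n)"

lemma THE_move_pair [simp]: "(THE j. {i, succ3 i} = {j, succ3 j}) = i"
  by (rule the_equality, simp) (cases i; case_tac j; auto simp: doubleton_eq_iff)

lemma set_greedy_R_move: "A \<noteq> {} \<Longrightarrow> set_pmf (greedy_R_move A) \<subseteq> A"
proof -
  assume ne: "A \<noteq> {}"
  have "A \<subseteq> {Rock, Paper, Scissors}"
    using UNIV_move by blast
  then have "A \<in> Pow {Rock, Paper, Scissors}" by simp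
  then consider "A = UNIV" | i where "A = {i, succ3 i}" | i where "A = {i}"
    using ne unfolding Pow_insert Pow_empty by (auto simp: UNIV_move) (metis insert_commute succ3.simps)+
  then show ?thesis
  proof cases
    case 1
    then show ?thesis by simp
  next
    case (2 i)
    have "card A = 2" unfolding 2 by (cases i) auto
    then show ?thesis unfolding greedy_R_move_def Let_def using 2 by auto
  next
    case (3 i)
    then show ?thesis by (simp add: greedy_R_move_def)
  qed
qed

end

theory Submission
  imports Defs "HOL-Real_Asymp.Real_Asymp"
begin

text \<open>
  Let \<open>N\<^sub>i\<close> be the number of times that R has played move \<open>i\<close>, and let the lead of \<open>i\<close> be
  \<open>D\<^sub>i = N\<^sub>i - N\<^sub>i\<^sub>+\<^sub>1\<close>. The proof compares the final score with the quantity
  \<open>score + max D\<^sub>i\<close> of an unrestricted game in which both players play uniformly in all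
  \<open>3 * n\<close> rounds.

  \<^bold>\<open>Comparison.\<close> Put \<open>L\<^sub>i = score + D\<^sub>i\<close>. Under the greedy strategies every \<open>L\<^sub>i\<close> has nonnegative
  drift, and drift zero as long as move \<open>i + 1\<close> is available (\<open>E_level_step_greedy\<close>); under
  uniform play all drifts vanish. Let the two games agree until some move of R is exhausted,
  and let \<open>X\<^sub>i\<close> be the difference of their levels \<open>L\<^sub>i\<close>. At the end of the greedy game all \<open>D\<^sub>i\<close>
  are zero, so its score minus the reference quantity is exactly \<open>min X\<^sub>i\<close>. The negative part of
  this minimum is controlled because each \<open>X\<^sub>i\<close> is a submartingale, the positive part because
  some \<open>X\<^sub>i\<close> is a martingale up to the last round. A quadratic potential shows that the mean
  square of the difference is at most a constant plus a multiple of the expected number of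
  rounds after the first exhaustion, which is \<open>o(n)\<close> by Chebyshev's inequality (\<open>coupling_error\<close>,
  \<open>exhaustion_prob_sum\<close>). Hence both variances agree up to \<open>o(n)\<close> (\<open>Var_perturb\<close>).

  \<^bold>\<open>Reference variance.\<close> In the uniform game the score has variance \<open>2 * n\<close> and is uncorrelated with
  every function of R's moves, so it remains to find the variance of \<open>max D\<^sub>i\<close> for three
  uniform counters with sum \<open>3 * n\<close>. On the sector \<open>N\<^sub>i > n \<ge> N\<^sub>i\<^sub>+\<^sub>1\<close> the maximal lead is \<open>D\<^sub>i\<close>,
  and these sectors cover all cases in which it is not zero. On a sector the size-bias
  identity \<open>tri_mean_size_bias\<close> makes the expectation of \<open>D\<^sub>i\<close> telescope to terms on the line
  where one counter equals \<open>n\<close>; that of \<open>D\<^sub>i\<^sup>2\<close> leaves a multiple of the probability of the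
  sector besides. This gives the first two moments of \<open>max D\<^sub>i\<close> in terms of the
  central trinomial and binomial probabilities (\<open>tri_mean_top_lead\<close>,
  \<open>tri_mean_top_lead_sq\<close>), whose asymptotics are limits of Gamma quotients.
\<close>

section \<open>Expectations over three uniform counters\<close>

text \<open>
  The expectation of \<open>f N\<^sub>1 N\<^sub>2 N\<^sub>3\<close> for the counters of three equally likely outcomes in \<open>k\<close>
  independent trials. The recursion replaces the trinomial distribution, so that identities
  follow by induction over \<open>k\<close> with \<open>f\<close> arbitrary.
\<close>
primrec tri_mean :: "nat \<Rightarrow> (nat \<Rightarrow> nat \<Rightarrow> nat \<Rightarrow> real) \<Rightarrow> real" where
  "tri_mean 0 f = f 0 0 0"
| "tri_mean (Suc k) f =
     (tri_mean k (\<lambda>a b c. f (Suc a) b c) + tri_mean k (\<lambda>a b c. f a (Suc b) c)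
      + tri_mean k (\<lambda>a b c. f a b (Suc c))) / 3"

lemma tri_mean_mono:
  "(\<And>a b c. a + b + c = k \<Longrightarrow> f a b c \<le> g a b c) \<Longrightarrow> tri_mean k f \<le> tri_mean k g"
proof (induction k arbitrary: f g)
  case (Suc k)
  show ?case
    by (auto intro!: add_mono divide_right_mono Suc)
qed auto

lemma tri_mean_cong:
  "(\<And>a b c. a + b + c = k \<Longrightarrow> f a b c = g a b c) \<Longrightarrow> tri_mean k f = tri_mean k g"
  by (intro antisym tri_mean_mono) auto

lemma tri_mean_add:
  "tri_mean k (\<lambda>a b c. f a b c + g a b c) = tri_mean k f + tri_mean k g"
  by (induction k arbitrary: f g) (auto simp: field_simps)

lemma tri_mean_cmult: "tri_mean k (\<lambda>a b c. x * f a b c) = x * tri_mean k f"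
  by (induction k arbitrary: f) (auto simp: field_simps)

lemma tri_mean_diff:
  "tri_mean k (\<lambda>a b c. f a b c - g a b c) = tri_mean k f - tri_mean k g"
  using tri_mean_add[of k f "\<lambda>a b c. - 1 * g a b c"] by (simp only: tri_mean_cmult) simp

lemma tri_mean_const: "tri_mean k (\<lambda>a b c. x) = x"
  by (induction k) auto

lemma tri_mean_rotate: "tri_mean k (\<lambda>a b c. f b c a) = tri_mean k f"
proof (induction k arbitrary: f)
  case (Suc k)
  show ?case
    using Suc[of "\<lambda>a b c. f (Suc a) b c"] Suc[of "\<lambda>a b c. f a (Suc b) c"] Suc[of "\<lambda>a b c. f a b (Suc c)"]
    by simp
qed simp

lemma tri_mean_swap: "tri_mean k (\<lambda>a b c. f b a c) = tri_mean k f"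
proof (induction k arbitrary: f)
  case (Suc k)
  show ?case
    using Suc[of "\<lambda>a b c. f (Suc a) b c"] Suc[of "\<lambda>a b c. f a (Suc b) c"] Suc[of "\<lambda>a b c. f a b (Suc c)"]
    by simp
qed simp

lemma tri_mean_swap23: "tri_mean k (\<lambda>a b c. f a c b) = tri_mean k f"
  using tri_mean_swap[of k "\<lambda>a b c. f b c a"] tri_mean_rotate[of k f] by simp

text \<open>
  Weighting by \<open>N\<^sub>1\<close> marks one of the trials with outcome 1; removing it leaves \<open>k\<close> unbiased
  trials. Differences of two such identities are what makes sums over a sector telescope.
\<close>
lemma tri_mean_size_bias:
  "tri_mean (Suc k) (\<lambda>a b c. real a * f a b c) = real (Suc k) / 3 * tri_mean k (\<lambda>a b c. f (Suc a) b c)"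
proof (induction k arbitrary: f)
  case (Suc k)
  have "tri_mean (Suc k) (\<lambda>a b c. real (Suc a) * f (Suc a) b c)
     = tri_mean (Suc k) (\<lambda>a b c. real a * f (Suc a) b c) + tri_mean (Suc k) (\<lambda>a b c. f (Suc a) b c)"
    unfolding tri_mean_add[symmetric] by (simp add: algebra_simps)
  then show ?case
    by (subst tri_mean.simps(2)) (simp only: Suc, simp add: field_simps)
qed auto

lemma tri_mean_size_bias2:
  "tri_mean (Suc k) (\<lambda>a b c. real b * f a b c) = real (Suc k) / 3 * tri_mean k (\<lambda>a b c. f a (Suc b) c)"
  using tri_mean_size_bias[of k "\<lambda>a b c. f b a c"]
    tri_mean_swap[of "Suc k" "\<lambda>a b c. real b * f a b c"] tri_mean_swap[of k "\<lambda>a b c. f a (Suc b) c"]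
  by simp

lemma tri_mean_size_bias3:
  "tri_mean (Suc k) (\<lambda>a b c. real c * f a b c) = real (Suc k) / 3 * tri_mean k (\<lambda>a b c. f a b (Suc c))"
  using tri_mean_size_bias2[of k "\<lambda>a b c. f c a b"]
    tri_mean_rotate[of "Suc k" "\<lambda>a b c. real b * f c a b"] tri_mean_rotate[of k "\<lambda>a b c. f c a (Suc b)"]
    tri_mean_rotate[of "Suc k" "\<lambda>a b c. real a * f b c a"] tri_mean_rotate[of k "\<lambda>a b c. f b c (Suc a)"]
  by simp

definition top_lead :: "nat \<Rightarrow> nat \<Rightarrow> nat \<Rightarrow> real" where
  "top_lead a b c = max (real a - real b) (max (real b - real c) (real c - real a))"

text \<open>
  For \<open>a + b + c = 3 * n\<close> the lead \<open>a - b\<close> is maximal if and only if \<open>a \<ge> n \<ge> b\<close>. Making the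
  first inequality strict turns the three closed sectors into a partition of everything but
  the point \<open>(n, n, n)\<close>: going around the cycle, exactly one counter above \<open>n\<close> is followed by
  one that is not.
\<close>
definition sector :: "nat \<Rightarrow> nat \<Rightarrow> nat \<Rightarrow> real" where
  "sector n a b = of_bool (n < a \<and> b \<le> n)"

lemma top_lead_sectors:
  assumes "a + b + c = 3 * n"
  shows "top_lead a b c ^ m * (1 - of_bool (a = n \<and> b = n))
    = (real a - real b) ^ m * sector n a b + (real b - real c) ^ m * sector n b c
           + (real c - real a) ^ m * sector n c a"
proof -
  consider "a > n" "b > n" "c \<le> n" | "a > n" "b \<le> n" "c > n" | "a > n" "b \<le> n" "c \<le> n"
    | "a \<le> n" "b > n" "c > n" | "a \<le> n" "b > n" "c \<le> n" | "a \<le> n" "b \<le> n" "c > n"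
    | "a = n" "b = n" "c = n"
    using assms by linarith
  then show ?thesis
  proof cases
    case 1
    then have "top_lead a b c = real b - real c" unfolding top_lead_def using assms by linarith
    with 1 show ?thesis by (simp add: sector_def)
  next
    case 2
    then have "top_lead a b c = real a - real b" unfolding top_lead_def using assms by linarith
    with 2 show ?thesis by (simp add: sector_def)
  next
    case 3
    then have "top_lead a b c = real a - real b" unfolding top_lead_def using assms by linarith
    with 3 show ?thesis by (simp add: sector_def)
  next
    case 4
    then have "top_lead a b c = real c - real a" unfolding top_lead_def using assms by linarith
    with 4 show ?thesis by (simp add: sector_def)
  next
    case 5
    then have "top_lead a b c = real b - real c" unfolding top_lead_def using assms by linarith
    with 5 show ?thesis by (simp add: sector_def)
  next
    case 6
    then have "top_lead a b c = real c - real a" unfolding top_lead_def using assms by linarith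
    with 6 assms show ?thesis by (auto simp: sector_def)
  next
    case 7
    then show ?thesis by (simp add: sector_def)
  qed
qed

text \<open>
  By rotational symmetry one sector suffices. The case \<open>m = 0\<close> gives the probability of a
  sector, \<open>m = 1\<close> and \<open>m = 2\<close> the moments of \<open>top_lead\<close>.
\<close>
lemma tri_mean_sectors:
  "tri_mean (3 * n) (\<lambda>a b c. top_lead a b c ^ m * (1 - of_bool (a = n \<and> b = n)))
     = 3 * tri_mean (3 * n) (\<lambda>a b c. (real a - real b) ^ m * sector n a b)"
proof -
  have 1: "tri_mean k (\<lambda>a b c. (real b - real c) ^ m * sector n b c)
    = tri_mean k (\<lambda>a b c. (real a - real b) ^ m * sector n a b)" for k
    by (rule tri_mean_rotate[of _ "\<lambda>a b c. (real a - real b) ^ m * sector n a b"])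
  have 2: "tri_mean k (\<lambda>a b c. (real c - real a) ^ m * sector n c a)
    = tri_mean k (\<lambda>a b c. (real b - real c) ^ m * sector n b c)" for k
    by (rule tri_mean_rotate[of _ "\<lambda>a b c. (real b - real c) ^ m * sector n b c"])
  have "tri_mean (3 * n) (\<lambda>a b c. top_lead a b c ^ m * (1 - of_bool (a = n \<and> b = n)))
     = tri_mean (3 * n) (\<lambda>a b c. (real a - real b) ^ m * sector n a b
       + (real b - real c) ^ m * sector n b c
           + (real c - real a) ^ m * sector n c a)"
    by (rule tri_mean_cong) (rule top_lead_sectors)
  then show ?thesis by (simp add: tri_mean_add 1 2)
qed

lemma top_lead_vanish: "m > 0 \<Longrightarrow> a + b + c = 3 * n
  \<Longrightarrow> top_lead a b c ^ m * (1 - of_bool (a = n \<and> b = n)) = top_lead a b c ^ m"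
  by (auto simp: top_lead_def)

definition hit :: "nat \<Rightarrow> real" where
  "hit n = tri_mean (3 * n - 1) (\<lambda>a b c. of_bool (a = n))"

text \<open>
  Size-biasing both terms of \<open>a - b\<close> compares the sector with two of its unit shifts. They
  differ only in the boundary half-lines \<open>a = n\<close>, \<open>b \<le> n\<close> and \<open>b = n\<close>, \<open>a > n\<close>, which a swap of
  the two counters joins to the full line \<open>a = n\<close>.
\<close>
lemma tri_mean_top_lead:
  assumes "n > 0"
  shows "tri_mean (3 * n) top_lead = 3 * real n * hit n"
proof -
  obtain k where k: "3 * n = Suc k" using assms by (cases n) auto
  then have k': "3 * n - 1 = k" "real (Suc k) / 3 = real n" by auto
  have "tri_mean (3 * n) top_lead
    = tri_mean (3*n) (\<lambda>a b c. top_lead a b c ^ 1 * (1 - of_bool (a = n \<and> b = n)))"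
    by (rule tri_mean_cong, subst top_lead_vanish) auto
  also have "\<dots> = 3 * tri_mean (3 * n) (\<lambda>a b c. real a * sector n a b - real b * sector n a b)"
    by (subst tri_mean_sectors) (simp add: algebra_simps)
  also have "tri_mean (3 * n) (\<lambda>a b c. real a * sector n a b - real b * sector n a b)
     = real n * tri_mean k (\<lambda>a b c. sector n (Suc a) b - sector n a (Suc b))"
    by (simp only: k tri_mean_diff tri_mean_size_bias
      tri_mean_size_bias2 k'(2)) (simp add: algebra_simps)
  also have "tri_mean k (\<lambda>a b c. sector n (Suc a) b - sector n a (Suc b))
     = tri_mean k (\<lambda>a b c. of_bool (a = n \<and> b \<le> n) + of_bool (b = n \<and> a > n))"
    by (rule tri_mean_cong) (auto simp: sector_def)
  also have "\<dots> = tri_mean k (\<lambda>a b c. of_bool (a = n \<and> b \<le> n))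
    + tri_mean k (\<lambda>a b c. of_bool (a = n \<and> b > n))"
    using tri_mean_swap[of k "\<lambda>a b c. of_bool (a = n \<and> b > n)"] by (simp add: tri_mean_add)
  also have "\<dots> = tri_mean k (\<lambda>a b c. of_bool (a = n))"
    by (subst tri_mean_add[symmetric]) (auto intro!: tri_mean_cong)
  finally show ?thesis unfolding hit_def k'(1) by simp
qed

definition spread :: "nat \<Rightarrow> real" where
  "spread n = tri_mean (3 * n - 1) (\<lambda>a b c. of_bool (a = n) * \<bar>real b - real n\<bar>)"

text \<open>
  The same telescoping applied to \<open>(a - b) * (a - b)\<close>. Now the remaining factor \<open>a - b\<close> changes
  by one under each shift, which leaves twice the probability of the interior of the sector,
  and it contributes the distance from the corner on the boundary line.
\<close>
lemma tri_mean_top_lead_sq: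
  assumes "n > 0"
  shows "tri_mean (3 * n) (\<lambda>a b c. top_lead a b c ^ 2)
    = 3 * real n * (2 * tri_mean (3 * n - 1) (\<lambda>a b c. of_bool (n < a \<and> b < n)) + hit n + spread n)"
proof -
  obtain k where k: "3 * n = Suc k" using assms by (cases n) auto
  then have k': "3 * n - 1 = k" "real (Suc k) / 3 = real n" by auto
  have "tri_mean (3 * n) (\<lambda>a b c. top_lead a b c ^ 2)
    = tri_mean (3*n) (\<lambda>a b c. top_lead a b c ^ 2 * (1 - of_bool (a = n \<and> b = n)))"
    by (rule tri_mean_cong, subst top_lead_vanish) auto
  also have "\<dots> = 3 * tri_mean (3 * n) (\<lambda>a b c. real a * ((real a - real b) * sector n a b)
    - real b * ((real a - real b) * sector n a b))"
    by (subst tri_mean_sectors) (simp add: algebra_simps power2_eq_square)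
  also have "tri_mean (3 * n) (\<lambda>a b c. real a * ((real a - real b) * sector n a b)
    - real b * ((real a - real b) * sector n a b))
     = real n * tri_mean k (\<lambda>a b c. (real (Suc a) - real b) * sector n (Suc a) b
       - (real a - real (Suc b)) * sector n a (Suc b))"
    by (simp only: k tri_mean_diff tri_mean_size_bias
      tri_mean_size_bias2 k'(2)) (simp add: algebra_simps)
  also have "tri_mean k (\<lambda>a b c. (real (Suc a) - real b) * sector n (Suc a) b
    - (real a - real (Suc b)) * sector n a (Suc b))
     = tri_mean k (\<lambda>a b c. 2 * of_bool (n < a \<and> b < n)
       + of_bool (a = n \<and> b \<le> n) * (1 + \<bar>real b - real n\<bar>)
          + of_bool (b = n \<and> a > n) * (1 + \<bar>real a - real n\<bar>))"
    by (rule tri_mean_cong) (auto simp: sector_def)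
  also have "\<dots> = 2 * tri_mean k (\<lambda>a b c. of_bool (n < a \<and> b < n))
     + (tri_mean k (\<lambda>a b c. of_bool (a = n \<and> b \<le> n) * (1 + \<bar>real b - real n\<bar>))
       + tri_mean k (\<lambda>a b c. of_bool (a = n \<and> b > n) * (1 + \<bar>real b - real n\<bar>)))"
    using tri_mean_swap[of k "\<lambda>a b c. of_bool (a = n \<and> b > n) * (1 + \<bar>real b - real n\<bar>)"]
      by (simp add: tri_mean_add tri_mean_cmult)
  also have "tri_mean k (\<lambda>a b c. of_bool (a = n \<and> b \<le> n) * (1 + \<bar>real b - real n\<bar>))
    + tri_mean k (\<lambda>a b c. of_bool (a = n \<and> b > n) * (1 + \<bar>real b - real n\<bar>))
     = hit n + spread n"
    unfolding hit_def spread_def k' tri_mean_add[symmetric] by (auto intro!: tri_mean_cong)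
  finally show ?thesis unfolding k'(1) by (simp add: add_ac)
qed

section \<open>Closed forms and their asymptotics\<close>

lemma tri_mean_one_count:
  "tri_mean (m + j) (\<lambda>a b c. of_bool (a = j)) = fact (m + j) / (fact j * fact m * 3 ^ j) * (2 / 3) ^ m"
proof (induction j)
  case 0
  have "tri_mean m (\<lambda>a b c. of_bool (a = 0)) = (2 / 3) ^ m"
    by (induction m) (auto simp: tri_mean_const)
  then show ?case by simp
next
  case (Suc j)
  have "real (Suc j) * tri_mean (Suc (m + j)) (\<lambda>a b c. of_bool (a = Suc j))
      = tri_mean (Suc (m + j)) (\<lambda>a b c. real a * of_bool (a = Suc j))"
    by (subst tri_mean_cmult[symmetric], rule tri_mean_cong) auto
  also have "\<dots> = real (Suc (m + j)) / 3 * tri_mean (m + j) (\<lambda>a b c. of_bool (a = j))"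
    by (subst tri_mean_size_bias) simp
  finally have step: "tri_mean (Suc (m + j)) (\<lambda>a b c. of_bool (a = Suc j))
     = real (Suc (m + j)) / 3 * tri_mean (m + j) (\<lambda>a b c. of_bool (a = j)) / real (Suc j)"
    by (simp add: field_simps del: tri_mean.simps of_nat_Suc)
  show ?case
    unfolding add_Suc_right step Suc by (simp add: field_simps)
qed

lemma tri_mean_two_counts:
  "tri_mean (l + j + i) (\<lambda>a b c. of_bool (a = i \<and> b = j))
    = fact (l + j + i) / (fact i * fact j * fact l * 3 ^ (l + j + i))"
proof (induction i)
  case 0
  show ?case
  proof (induction j)
    case 0
    have "tri_mean l (\<lambda>a b c. of_bool (a = 0 \<and> b = 0)) = (1 / 3) ^ l"
      by (induction l) (auto simp: tri_mean_const)
    then show ?case by (simp add: power_divide)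
  next
    case (Suc j)
    have "real (Suc j) * tri_mean (Suc (l + j)) (\<lambda>a b c. of_bool (a = 0 \<and> b = Suc j))
      = tri_mean (Suc (l + j)) (\<lambda>a b c. real b * of_bool (a = 0 \<and> b = Suc j))"
      by (subst tri_mean_cmult[symmetric], rule tri_mean_cong) auto
    also have "\<dots> = real (Suc (l + j)) / 3 * tri_mean (l + j) (\<lambda>a b c. of_bool (a = 0 \<and> b = j))"
      by (subst tri_mean_size_bias2) simp
    finally have step: "tri_mean (Suc (l + j)) (\<lambda>a b c. of_bool (a = 0 \<and> b = Suc j))
       = real (Suc (l + j)) / 3 * tri_mean (l + j) (\<lambda>a b c. of_bool (a = 0 \<and> b = j)) / real (Suc j)"
      by (simp add: field_simps del: tri_mean.simps of_nat_Suc)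
    show ?case
      unfolding add_0_right add_Suc_right step Suc[unfolded add_0_right] by (simp add: field_simps)
  qed
next
  case (Suc i)
  have "real (Suc i) * tri_mean (Suc (l + j + i)) (\<lambda>a b c. of_bool (a = Suc i \<and> b = j))
    = tri_mean (Suc (l + j + i)) (\<lambda>a b c. real a * of_bool (a = Suc i \<and> b = j))"
    by (subst tri_mean_cmult[symmetric], rule tri_mean_cong) auto
  also have "\<dots> = real (Suc (l + j + i)) / 3 * tri_mean (l + j + i) (\<lambda>a b c. of_bool (a = i \<and> b = j))"
    by (subst tri_mean_size_bias) simp
  finally have step: "tri_mean (Suc (l + j + i)) (\<lambda>a b c. of_bool (a = Suc i \<and> b = j))
     = real (Suc (l + j + i)) / 3
       * tri_mean (l + j + i) (\<lambda>a b c. of_bool (a = i \<and> b = j)) / real (Suc i)"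
    by (simp add: field_simps del: tri_mean.simps of_nat_Suc)
  show ?case
    unfolding add_Suc_right step Suc by (simp add: field_simps)
qed

definition central_tri :: "nat \<Rightarrow> real" where
  "central_tri n = fact (3 * n) / (fact n ^ 3 * 27 ^ n)"

definition central_bin :: "nat \<Rightarrow> real" where
  "central_bin n = fact (2 * n) / (fact n ^ 2 * 4 ^ n)"

text \<open>
  A counter is as likely to be \<open>n\<close> after \<open>3 * n - 1\<close> trials as after \<open>3 * n\<close> trials. In the latter
  case the other two are then \<open>n\<close> as well with conditional probability \<open>central_bin n\<close>.
\<close>
lemma hit_eq: "n > 0 \<Longrightarrow> hit n = central_tri n / central_bin n"
proof -
  assume "n > 0"
  then obtain m where n: "n = Suc m" by (cases n) auto
  have k: "3 * n - 1 = (2 * m + 1) + Suc m" by (simp add: n)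
  have f: "fact (2 * m + 1 + Suc m) * (3 * real m + 3) = (fact (3 * n) :: real)"
  proof -
    have "3 * n = Suc (2 * m + 1 + Suc m)" by (simp add: n)
    then show ?thesis by (simp only: fact_Suc) simp
  qed
  have g: "fact (2 * m + 1) * (2 * real m + 2) = (fact (2 * n) :: real)"
  proof -
    have "2 * n = Suc (2 * m + 1)" by (simp add: n)
    then show ?thesis by (simp only: fact_Suc) simp
  qed
  have "hit n = fact (2 * m + 1 + Suc m) / (fact n * fact (2 * m + 1) * 3 ^ n) * (2 / 3) ^ (2 * m + 1)"
    unfolding hit_def k by (subst n, subst tri_mean_one_count) (simp add: n)
  also have "fact (2 * m + 1 + Suc m) = fact (3 * n) / (3 * real m + 3 :: real)"
    using f by (simp add: field_simps)
  also have "fact (2 * m + 1) = fact (2 * n) / (2 * real m + 2 :: real)"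
    using g by (simp add: field_simps)
  also have "(2 / 3 :: real) ^ (2 * m + 1) = 3 / 2 * (4 ^ n / 9 ^ n)"
    by (simp add: n power_divide power_mult)
  also have "fact (3 * n) / (3 * real m + 3) / (fact n * (fact (2 * n) / (2 * real m + 2)) * 3 ^ n)
    * (3 / 2 * (4 ^ n / 9 ^ n))
     = fact (3 * n) * 4 ^ n / (fact n * fact (2 * n) * (3 ^ n * 9 ^ n))"
    by (simp add: divide_simps)
  also have "(3::real) ^ n * 9 ^ n = 27 ^ n" by (simp flip: power_mult_distrib)
  finally show ?thesis
    by (simp add: central_tri_def central_bin_def power2_eq_square power3_eq_cube)
qed

text \<open>
  On the line \<open>a = n\<close> the other counters satisfy \<open>b + c = 2 * n - 1\<close>. Exchanging them on the half
  \<open>b < n\<close> turns the mean of \<open>\<bar>b - n\<bar>\<close> into that of \<open>b - c\<close> over the half \<open>b \<ge> n\<close>, and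
  size-biasing telescopes the latter to a single point of the trinomial distribution.
\<close>
lemma spread_eq: "n > 0 \<Longrightarrow> spread n = real n * central_tri n"
proof -
  assume "n > 0"
  then obtain m where n: "n = Suc m" by (cases n) auto
  have k: "3 * n - 1 = Suc (m + m + n)" by (simp add: n)
  let ?k = "Suc (m + m + n)"
  let ?I = "\<lambda>a b. of_bool (a = n \<and> n \<le> b) :: real"
  have "spread n = tri_mean ?k (\<lambda>a b c. ?I a b * (real b - real n) + ?I a c * (real c - real n + 1))"
    unfolding spread_def k by (rule tri_mean_cong) (auto simp: n)
  also have "\<dots> = tri_mean ?k (\<lambda>a b c. ?I a b * (real b - real n))
    + tri_mean ?k (\<lambda>a b c. ?I a b * (real b - real n + 1))"
    using tri_mean_swap23[of ?k "\<lambda>a b c. ?I a b * (real b - real n + 1)"] by (simp only: tri_mean_add)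
  also have "\<dots> = tri_mean ?k (\<lambda>a b c. real b * ?I a b - real c * ?I a b)"
    unfolding tri_mean_add[symmetric] by (rule tri_mean_cong) (auto simp: n)
  also have "\<dots> = real ?k / 3 * tri_mean (m + m + n) (\<lambda>a b c. ?I a (Suc b) - ?I a b)"
    by (simp only: tri_mean_diff tri_mean_size_bias2 tri_mean_size_bias3) (simp add: algebra_simps)
  also have "tri_mean (m + m + n) (\<lambda>a b c. ?I a (Suc b) - ?I a b)
    = tri_mean (m + m + n) (\<lambda>a b c. of_bool (a = n \<and> b = m))"
    by (rule tri_mean_cong) (auto simp: n)
  also have "\<dots> = fact (m + m + n) / (fact n * fact m * fact m * 3 ^ (m + m + n))"
    by (rule tri_mean_two_counts)
  also have "fact (m + m + n) = fact (3 * n) / ((3 * real m + 3) * (3 * real m + 2) :: real)"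
  proof -
    have "3 * n = Suc (Suc (m + m + n))" by (simp add: n)
    then have "fact (3 * n) = (3 * real m + 3) * (3 * real m + 2) * fact (m + m + n)"
      by (simp only: fact_Suc) (simp add: n add_ac)
    then show ?thesis by simp
  qed
  also have "(3::real) ^ (m + m + n) = 27 ^ n / 9"
  proof -
    have "(3::real) ^ (m + m + n) * 9 = 3 ^ (3 * n)"
      by (simp add: n power_add power_mult flip: power_mult_distrib)
    then show ?thesis by (simp add: power_mult)
  qed
  also have "fact m = fact n / (real m + 1)" by (simp add: n field_simps)
  also have "real (Suc (m + m + n)) / 3 * (fact (3 * n) / ((3 * real m + 3) * (3 * real m + 2))
      / (fact n * (fact n / (real m + 1)) * (fact n / (real m + 1)) * (27 ^ n / 9)))
    = (real m + 1) * (fact (3 * n) / (fact n * fact n * fact n * 27 ^ n))"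
  proof -
    have eq: "real (Suc (m + m + n)) = 3 * real m + 2" "3 * real m + 3 = 3 * (real m + 1)"
      by (simp_all add: n)
    have "x / 3 * (F / ((3 * y) * x) / (f * (f / y) * (f / y) * (t / 9))) = y * (F / (f * f * f * t))"
      if "x > 0" "y > 0" "f > 0" "t > 0" for x y F f t :: real
      using that by (simp add: field_simps)
    from this[of "3 * real m + 2" "real m + 1" "fact n" "27 ^ n" "fact (3 * n)"] show ?thesis
      unfolding eq by simp
  qed
  finally show ?thesis
    by (simp add: central_tri_def power3_eq_cube n add_ac del: fact_Suc)
qed

lemma central_tri_pochhammer: "central_tri n = pochhammer (1/3) n * pochhammer (2/3) n / fact n ^ 2"
proof (induction n)
  case (Suc n)
  have f: "(fact (3 * Suc n) :: real)
    = (3 * real n + 3) * (3 * real n + 2) * (3 * real n + 1) * fact (3 * n)"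
  proof -
    have "3 * Suc n = Suc (Suc (Suc (3 * n)))" by simp
    then show ?thesis by (simp only: fact_Suc) (simp add: add_ac)
  qed
  have "central_tri (Suc n) = central_tri n * ((real n + 1 / 3) * (real n + 2 / 3) / (real n + 1) ^ 2)"
    unfolding central_tri_def f
      by (simp add: divide_simps power2_eq_square power3_eq_cube) (simp add: algebra_simps)
  then show ?case unfolding Suc
    by (simp add: pochhammer_Suc divide_simps power2_eq_square) (simp add: algebra_simps)
qed (simp add: central_tri_def)

lemma central_bin_pochhammer: "central_bin n = pochhammer (1/2) n / fact n"
proof (induction n)
  case (Suc n)
  have f: "(fact (2 * Suc n) :: real) = (2 * real n + 2) * (2 * real n + 1) * fact (2 * n)"
  proof -
    have "2 * Suc n = Suc (Suc (2 * n))" by simp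
    then show ?thesis by (simp only: fact_Suc) (simp add: add_ac)
  qed
  have "central_bin (Suc n) = central_bin n * ((real n + 1 / 2) / (real n + 1))"
    unfolding central_bin_def f by (simp add: divide_simps power2_eq_square) (simp add: algebra_simps)
  then show ?case unfolding Suc
    by (simp add: pochhammer_Suc divide_simps) (simp add: algebra_simps)
qed (simp add: central_bin_def)

text \<open>
  In terms of Gauss's limit formula for Gamma the constant is \<open>1 / (\<Gamma>(1/3) \<Gamma>(2/3))\<close>, which the
  reflection formula evaluates.
\<close>
lemma central_tri_asymp: "(\<lambda>n. real n * central_tri n) \<longlonglongrightarrow> sqrt 3 / (2 * pi)"
proof -
  let ?G = "\<lambda>n. Gamma_series (1/3::real) n * Gamma_series (2/3) n"
  have G: "Gamma (1/3) * Gamma (2/3 :: real) = 2 * pi / sqrt 3"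
  proof -
    have "complex_of_real (Gamma (1/3) * Gamma (2/3)) = Gamma (1/3) * Gamma (1 - 1/3)"
      by (simp flip: Gamma_complex_of_real)
    also have "\<dots> = of_real (pi / sin (pi / 3))"
      by (subst Gamma_reflection_complex) (simp flip: sin_of_real)
    finally show ?thesis
      by (simp only: of_real_eq_iff sin_60) simp
  qed
  have "?G \<longlonglongrightarrow> 2 * pi / sqrt 3"
    unfolding G[symmetric] by (intro tendsto_mult Gamma_series_LIMSEQ)
  moreover have "(\<lambda>n. real n ^ 2 / ((real n + 1/3) * (real n + 2/3))) \<longlonglongrightarrow> 1"
    by real_asymp
  ultimately have "(\<lambda>n. real n ^ 2 / ((real n + 1/3) * (real n + 2/3)) / ?G n) \<longlonglongrightarrow> 1 / (2 * pi / sqrt 3)"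
    by (intro tendsto_divide) auto
  moreover have "eventually (\<lambda>n. real n ^ 2 / ((real n + 1/3) * (real n + 2/3)) / ?G n
    = real n * central_tri n) at_top"
    using eventually_gt_at_top[of 0]
  proof eventually_elim
    case (elim n)
    have p: "pochhammer (1/3::real) n > 0" "pochhammer (2/3::real) n > 0"
      by (auto intro!: pochhammer_pos)
    have e: "exp (1/3 * ln (real n)) * exp (2/3 * ln (real n)) = real n"
      using elim by (simp flip: exp_add)
    have G: "?G n = fact n ^ 2
      * (exp (1/3 * ln (real n)) * exp (2/3 * ln (real n))) / (pochhammer (1/3) n * (real n + 1/3)
        * (pochhammer (2/3) n * (real n + 2/3)))"
      by (simp add: Gamma_series_def pochhammer_Suc power2_eq_square add_ac mult_ac)
    show ?case
      unfolding central_tri_pochhammer G e using p elim by (simp add: power2_eq_square)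
  qed
  ultimately show ?thesis
    by (simp add: tendsto_cong)
qed

lemma central_bin_asymp: "(\<lambda>n. sqrt (real n) * central_bin n) \<longlonglongrightarrow> 1 / sqrt pi"
proof -
  let ?G = "\<lambda>n. Gamma_series (1/2::real) n"
  have "?G \<longlonglongrightarrow> sqrt pi"
    unfolding Gamma_one_half_real[symmetric] by (rule Gamma_series_LIMSEQ)
  moreover have "(\<lambda>n. real n / (real n + 1/2)) \<longlonglongrightarrow> 1"
    by real_asymp
  ultimately have "(\<lambda>n. real n / (real n + 1/2) / ?G n) \<longlonglongrightarrow> 1 / sqrt pi"
    by (intro tendsto_divide) auto
  moreover have "eventually (\<lambda>n. real n / (real n + 1/2) / ?G n = sqrt (real n) * central_bin n) at_top"
    using eventually_gt_at_top[of 0]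
  proof eventually_elim
    case (elim n)
    have p: "pochhammer (1/2::real) n > 0" by (auto intro!: pochhammer_pos)
    have "exp (1/2 * ln (real n)) * exp (1/2 * ln (real n)) = real n"
      using elim by (simp flip: exp_add)
    then have e: "exp (1/2 * ln (real n)) = sqrt (real n)"
      by (metis abs_of_pos exp_gt_zero real_sqrt_mult_self real_sqrt_abs2)
    have G: "?G n = fact n * sqrt (real n) / (pochhammer (1/2) n * (real n + 1/2))"
      using e by (simp add: Gamma_series_def pochhammer_Suc add_ac)
    have "a / b / (f * s / (q * b)) = s * (q / f)" if "a
      = s * s" "b > 0" "f > 0" "s > 0" "q > 0" for a b f s q :: real
      using that by (simp add: field_simps)
    from this[of "real n" "sqrt (real n)"] show ?case
      unfolding central_bin_pochhammer G using p elim by simp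
  qed
  ultimately show ?thesis
    by (simp add: tendsto_cong)
qed

lemma top_lead_mean_asymp:
  "(\<lambda>n. tri_mean (3 * n) top_lead / sqrt (real n)) \<longlonglongrightarrow> 3 * sqrt 3 / (2 * sqrt pi)"
proof -
  have "(\<lambda>n. 3 * (real n * central_tri n) / (sqrt (real n) * central_bin n))
    \<longlonglongrightarrow> 3 * (sqrt 3 / (2 * pi)) / (1 / sqrt pi)"
    by (intro tendsto_intros central_tri_asymp central_bin_asymp) auto
  also have "3 * (sqrt 3 / (2 * pi)) / (1 / sqrt pi) = 3 * sqrt 3 / (2 * sqrt pi)"
    by (simp add: field_simps)
  also have "(\<lambda>n. 3 * (real n * central_tri n) / (sqrt (real n) * central_bin n))
    = (\<lambda>n. tri_mean (3 * n) top_lead / sqrt (real n))"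
  proof
    fix n :: nat
    show "3 * (real n * central_tri n) / (sqrt (real n) * central_bin n)
      = tri_mean (3 * n) top_lead / sqrt (real n)"
      by (cases "n = 0") (simp_all only: tri_mean_top_lead hit_eq neq0_conv, simp_all add: mult.commute)
  qed
  finally show ?thesis .
qed

lemma hit_tendsto: "hit \<longlonglongrightarrow> 0"
proof -
  have "(\<lambda>n. (real n * central_tri n) / (sqrt (real n) * central_bin n) * (1 / sqrt (real n)))
    \<longlonglongrightarrow> (sqrt 3 / (2 * pi)) / (1 / sqrt pi) * 0"
  proof (intro tendsto_mult tendsto_divide central_tri_asymp central_bin_asymp)
    show "(\<lambda>n. 1 / sqrt (real n)) \<longlonglongrightarrow> 0" by real_asymp
  qed auto
  moreover have "eventually (\<lambda>n. (real n * central_tri n) / (sqrt (real n) * central_bin n)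
    * (1 / sqrt (real n)) = hit n) at_top"
    using eventually_gt_at_top[of 0] by eventually_elim (simp add: hit_eq real_div_sqrt field_simps)
  ultimately show ?thesis by (simp add: tendsto_cong)
qed

text \<open>
  The three sectors are equally likely and miss only the central point.
\<close>
lemma tri_mean_sector: "tri_mean (3 * n) (\<lambda>a b c. sector n a b) = (1 - central_tri n) / 3"
proof -
  have "3 * tri_mean (3 * n) (\<lambda>a b c. sector n a b)
    = 1 - tri_mean (3 * n) (\<lambda>a b c. of_bool (a = n \<and> b = n))"
    using tri_mean_sectors[of n 0] by (simp add: tri_mean_diff tri_mean_const del: of_bool_conj)
  also have "3 * n = n + n + n" by simp
  then have "tri_mean (3 * n) (\<lambda>a b c. of_bool (a = n \<and> b = n))
    = fact (3 * n) / (fact n * fact n * fact n * 3 ^ (3 * n))"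
    using tri_mean_two_counts[of n n n] by (simp only:)
  also have "\<dots> = central_tri n"
    by (simp add: central_tri_def power3_eq_cube power_mult)
  finally show ?thesis by simp
qed

text \<open>
  One more trial moves a point of the open sector into the half-open one, and the converse
  fails only on the lines \<open>a = n\<close> and \<open>b = n\<close>, each of probability \<open>hit n\<close>.
\<close>
lemma strict_sector_bounds:
  assumes "n > 0"
  defines "p \<equiv> tri_mean (3 * n - 1) (\<lambda>a b c. of_bool (n < a \<and> b < n))"
  shows "(1 - central_tri n) / 3 - 2 * hit n \<le> p" "p \<le> (1 - central_tri n) / 3"
proof -
  obtain k where k: "3 * n = Suc k" using assms by (cases n) auto
  then have k': "3 * n - 1 = k" by auto
  have avg: "x \<le> u \<Longrightarrow> y \<le> u \<Longrightarrow> z \<le> u \<Longrightarrow> (x + y + z) / 3 \<le> u"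
    "u \<le> x \<Longrightarrow> u \<le> y \<Longrightarrow> u \<le> z \<Longrightarrow> u \<le> (x + y + z) / 3" for x y z u :: real
    by simp_all
  define q where "q = p + 2 * hit n"
  have "hit n = tri_mean k (\<lambda>a b c. of_bool (b = n))"
    using tri_mean_swap[of k "\<lambda>a b c. of_bool (a = n)"] unfolding hit_def k' by simp
  then have q: "q = tri_mean k (\<lambda>a b c. of_bool (n < a \<and> b < n) + (of_bool (a = n) + of_bool (b = n)))"
    unfolding q_def p_def k' tri_mean_add hit_def by simp
  have s: "(1 - central_tri n) / 3
    = (tri_mean k (\<lambda>a b c. sector n (Suc a) b) + tri_mean k (\<lambda>a b c. sector n a (Suc b))
      + tri_mean k (\<lambda>a b c. sector n a b)) / 3"
    unfolding tri_mean_sector[symmetric] k by simp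
  have "tri_mean k (\<lambda>a b c. sector n (Suc a) b) \<le> q" "tri_mean k (\<lambda>a b c. sector n a (Suc b))
    \<le> q" "tri_mean k (\<lambda>a b c. sector n a b) \<le> q"
    unfolding q by (auto intro!: tri_mean_mono simp: sector_def)
  then have "(1 - central_tri n) / 3 \<le> q" unfolding s by (rule avg(1))
  then show "(1 - central_tri n) / 3 - 2 * hit n \<le> p" by (simp only: q_def diff_le_eq)
  have "p \<le> tri_mean k (\<lambda>a b c. sector n (Suc a) b)" "p
    \<le> tri_mean k (\<lambda>a b c. sector n a (Suc b))" "p \<le> tri_mean k (\<lambda>a b c. sector n a b)"
    unfolding p_def k' by (auto intro!: tri_mean_mono simp: sector_def)
  then show "p \<le> (1 - central_tri n) / 3" unfolding s by (rule avg(2))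
qed

lemma top_lead_sq_asymp:
  "(\<lambda>n. tri_mean (3 * n) (\<lambda>a b c. top_lead a b c ^ 2) / real n) \<longlonglongrightarrow> 2 + 3 * sqrt 3 / (2 * pi)"
proof -
  let ?p = "\<lambda>n. tri_mean (3 * n - 1) (\<lambda>a b c. of_bool (n < a \<and> b < n))"
  have "(\<lambda>n. real n * central_tri n * (1 / real n)) \<longlonglongrightarrow> sqrt 3 / (2 * pi) * 0"
    by (intro tendsto_mult central_tri_asymp) real_asymp
  moreover have "eventually (\<lambda>n. real n * central_tri n * (1 / real n) = central_tri n) at_top"
    using eventually_gt_at_top[of 0] by eventually_elim simp
  ultimately have tri: "central_tri \<longlonglongrightarrow> 0"
    by (simp add: tendsto_cong)
  have p: "?p \<longlonglongrightarrow> 1 / 3"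
  proof (rule tendsto_sandwich)
    show "eventually (\<lambda>n. (1 - central_tri n) / 3 - 2 * hit n \<le> ?p n) at_top"
      using eventually_gt_at_top[of 0] by eventually_elim (rule strict_sector_bounds)
    show "eventually (\<lambda>n. ?p n \<le> (1 - central_tri n) / 3) at_top"
      using eventually_gt_at_top[of 0] by eventually_elim (rule strict_sector_bounds)
    have "(\<lambda>n. (1 - central_tri n) / 3 - 2 * hit n) \<longlonglongrightarrow> (1 - 0) / 3 - 2 * 0"
      by (intro tendsto_intros tri hit_tendsto) auto
    then show "(\<lambda>n. (1 - central_tri n) / 3 - 2 * hit n) \<longlonglongrightarrow> 1 / 3" by simp
    have "(\<lambda>n. (1 - central_tri n) / 3) \<longlonglongrightarrow> (1 - 0) / 3"
      by (intro tendsto_intros tri) auto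
    then show "(\<lambda>n. (1 - central_tri n) / 3) \<longlonglongrightarrow> 1 / 3" by simp
  qed
  have "(\<lambda>n. 3 * (2 * ?p n + hit n + real n * central_tri n))
    \<longlonglongrightarrow> 3 * (2 * (1 / 3) + 0 + sqrt 3 / (2 * pi))"
    by (intro tendsto_intros p hit_tendsto central_tri_asymp)
  moreover have "eventually (\<lambda>n. 3 * (2 * ?p n + hit n + real n * central_tri n)
    = tri_mean (3 * n) (\<lambda>a b c. top_lead a b c ^ 2) / real n) at_top"
    using eventually_gt_at_top[of 0] by eventually_elim (simp only: tri_mean_top_lead_sq spread_eq, simp)
  ultimately show ?thesis
    by (simp add: tendsto_cong algebra_simps)
qed

section \<open>One round of the greedy game\<close>

abbreviation E :: "'a pmf \<Rightarrow> ('a \<Rightarrow> real) \<Rightarrow> real" where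
  "E p f \<equiv> measure_pmf.expectation p f"

lemma finite_pmf_of_finite_type [simp]: "finite (set_pmf (p :: 'a :: finite pmf))"
  by (rule finite)

lemma E_mono:
  assumes "finite (set_pmf p)" "\<And>x. x \<in> set_pmf p \<Longrightarrow> f x \<le> g x"
  shows "E p f \<le> E p g"
  using assms by (intro integral_mono_AE integrable_measure_pmf_finite) (auto simp: AE_measure_pmf_iff)

lemma E_cong:
  "(\<And>x. x \<in> set_pmf p \<Longrightarrow> f x = g x) \<Longrightarrow> E p f = E p g"
  by (intro integral_cong_AE) (auto simp: AE_measure_pmf_iff)

lemma E_add: "finite (set_pmf p) \<Longrightarrow> E p (\<lambda>x. f x + g x) = E p f + E p g"
  by (intro Bochner_Integration.integral_add integrable_measure_pmf_finite)

lemma E_diff: "finite (set_pmf p) \<Longrightarrow> E p (\<lambda>x. f x - g x) = E p f - E p g"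
  by (intro Bochner_Integration.integral_diff integrable_measure_pmf_finite)

lemma E_sum: "finite (set_pmf p) \<Longrightarrow> E p (\<lambda>x. \<Sum>i\<in>I. f i x) = (\<Sum>i\<in>I. E p (f i))"
  by (intro Bochner_Integration.integral_sum integrable_measure_pmf_finite)

lemma E_bind:
  assumes "finite (set_pmf p)" "\<And>x. x \<in> set_pmf p \<Longrightarrow> finite (set_pmf (f x))"
  shows "E (bind_pmf p f) h = E p (\<lambda>x. E (f x) h)"
  using assms
  by (subst pmf_expectation_bind[of "set_pmf p"]) (auto simp: integral_measure_pmf[of "set_pmf p"])

lemma E_pair:
  assumes "finite (set_pmf p)" "finite (set_pmf q)"
  shows "E (pair_pmf p q) h = E p (\<lambda>x. E q (\<lambda>y. h (x, y)))"
  using assms by (simp add: pair_pmf_def E_bind)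

lemma sum_move: "sum f (UNIV :: move set) = f Rock + f Paper + f Scissors"
  by (simp add: UNIV_move add_ac)

abbreviation uniform_move :: "move pmf" where
  "uniform_move \<equiv> pmf_of_set UNIV"

lemma E_uniform_move: "E uniform_move f = (f Rock + f Paper + f Scissors) / 3"
  by (simp add: integral_pmf_of_set sum_move) (simp add: UNIV_move)

definition round_score :: "move \<times> move \<Rightarrow> real" where
  "round_score m = real_of_int (score [m])"

lemma score_snoc: "real_of_int (score (h @ [m])) = real_of_int (score h) + round_score m"
  by (cases m) (simp add: score_def round_score_def)

lemma round_score_simp: "round_score (r, s) = of_bool (s = succ3 r) - of_bool (r = succ3 s)"
  by (simp add: round_score_def score_def beats_def)

definition count_move :: "move \<Rightarrow> history \<Rightarrow> nat" where
  "count_move i h = count_list (map fst h) i"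

lemma count_move_Nil [simp]: "count_move i [] = 0"
  by (simp add: count_move_def)

lemma count_move_snoc [simp]: "count_move i (h @ [m]) = count_move i h + of_bool (fst m = i)"
  by (simp add: count_move_def)

lemma sum_count_move: "count_move Rock h + count_move Paper h + count_move Scissors h = length h"
proof (induction h rule: rev_induct)
  case (snoc m h)
  then show ?case by (cases "fst m") auto
qed simp

lemma available_eq: "available n h = {i. count_move i h < n}"
  by (simp add: available_def count_move_def)

text \<open>
  The process \<open>L\<^sub>i\<close>. In the greedy game its largest value over \<open>i\<close> is a forecast of the final
  score, which becomes exact at the end.
\<close>
definition level :: "move \<Rightarrow> history \<Rightarrow> real" where
  "level i h = real_of_int (score h) + real (count_move i h) - real (count_move (succ3 i) h)"

definition level_step :: "move \<Rightarrow> move \<times> move \<Rightarrow> real" where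
  "level_step i m = round_score m + of_bool (fst m = i) - of_bool (fst m = succ3 i)"

lemma level_snoc: "level i (h @ [m]) = level i h + level_step i m"
  by (simp add: level_def level_step_def score_snoc)

lemma abs_level_step: "\<bar>level_step i m\<bar> \<le> 2"
proof (cases m)
  case (Pair r s)
  then show ?thesis
    by (cases i; cases r; cases s) (simp_all add: level_step_def round_score_simp)
qed

definition uniform_round :: "(move \<times> move) pmf" where
  "uniform_round = pair_pmf uniform_move uniform_move"

lemma finite_uniform_round [simp]: "finite (set_pmf uniform_round)"
  by simp

lemma E_uniform_round: "E uniform_round f = E uniform_move (\<lambda>r. E uniform_move (\<lambda>s. f (r, s)))"
  unfolding uniform_round_def by (rule E_pair) simp_all

lemma E_level_step_uniform: "E uniform_round (level_step i) = 0"
  unfolding E_uniform_round E_uniform_move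
  by (cases i) (simp_all add: level_step_def round_score_simp)

definition greedy_round :: "move set \<Rightarrow> (move \<times> move) pmf" where
  "greedy_round A = pair_pmf (greedy_R_move A) (greedy_N_move A)"

lemma finite_greedy_round [simp]: "finite (set_pmf (greedy_round A))"
  by simp

lemma move_set_cases:
  assumes "A \<noteq> {}"
  obtains "A = UNIV" | j where "A = {j, succ3 j}" | j where "A = {j}"
proof -
  define p q r where "p = (Rock \<in> A)" and "q = (Paper \<in> A)" and "r = (Scissors \<in> A)"
  have A: "A = (if p then {Rock} else {}) \<union> (if q then {Paper} else {}) \<union> (if r then {Scissors} else {})"
  proof (rule set_eqI)
    fix x show "x \<in> A \<longleftrightarrow> x \<in> (if p then {Rock} else {}) \<union> (if q then {Paper} else {})
      \<union> (if r then {Scissors} else {})"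
      by (cases x) (simp_all add: p_def q_def r_def)
  qed
  then consider "A = {Rock, Paper, Scissors}" | "A = {Rock, Paper}" | "A = {Paper, Scissors}" | "A
    = {Scissors, Rock}"
    | "A = {Rock}" | "A = {Paper}" | "A = {Scissors}"
    using assms by (cases p; cases q; cases r) (simp_all add: insert_commute)
  then show ?thesis
    using that(1) that(2)[of Rock] that(2)[of Paper] that(2)[of Scissors] that(3)
      by cases (simp_all add: UNIV_move)
qed

lemma card_move_pair: "card {j, succ3 j} = 2"
  by (cases j) auto

lemma card_move_UNIV: "card (UNIV :: move set) = 3"
  by (simp add: UNIV_move)

lemma greedy_round_UNIV: "greedy_round UNIV = uniform_round"
  by (simp add: greedy_round_def greedy_R_move_def greedy_N_move_def card_move_UNIV uniform_round_def)

lemma greedy_round_pair: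
  "greedy_round {j, succ3 j} = pair_pmf (map_pmf (\<lambda>b. if b then j else succ3 j) (bernoulli_pmf (1/3)))
     (map_pmf (\<lambda>b. if b then succ3 j else succ3 (succ3 j)) (bernoulli_pmf (2/3)))"
  by (simp add: greedy_round_def greedy_R_move_def greedy_N_move_def card_move_pair)

lemma greedy_round_single: "greedy_round {j} = return_pmf (j, succ3 j)"
  by (simp add: greedy_round_def greedy_R_move_def greedy_N_move_def pair_return_pmf1)

lemma E_level_step_pair:
  "E (greedy_round {j, succ3 j}) (level_step i) = of_bool (i = succ3 j)"
proof -
  have "E (greedy_round {j, succ3 j}) (level_step i) =
     (level_step i (j, succ3 j) * (2/3) + level_step i (j, succ3 (succ3 j)) * (1/3)) * (1/3)
     + (level_step i (succ3 j, succ3 j) * (2/3) + level_step i (succ3 j, succ3 (succ3 j)) * (1/3))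
       * (2/3)"
    unfolding greedy_round_pair by (subst E_pair) simp_all
  also have "\<dots> = of_bool (i = succ3 j)"
    by (cases i; cases j) (simp_all add: level_step_def round_score_simp)
  finally show ?thesis .
qed

lemma E_level_step_single:
  "E (greedy_round {j}) (level_step i) = of_bool (i = j) * 2 + of_bool (i = succ3 j)"
  unfolding greedy_round_single
  by (cases i; cases j) (simp_all add: level_step_def round_score_simp)

text \<open>
  With moves \<open>j\<close> and \<open>j + 1\<close> available, the gain \<open>1/3\<close> of N balances the drift \<open>-1/3\<close> of the leads
  of \<open>j - 1\<close> and \<open>j\<close>, while the lead of \<open>j + 1\<close> rises by \<open>2/3\<close>. With only \<open>j\<close> available, N gains
  1 and only the lead of \<open>j - 1\<close> falls.
\<close>
lemma E_level_step_greedy: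
  assumes "A \<noteq> {}"
  shows "E (greedy_round A) (level_step i) \<ge> 0"
    and "succ3 i \<in> A \<Longrightarrow> E (greedy_round A) (level_step i) = 0"
proof -
  have *: "E (greedy_round A) (level_step i) \<ge> 0 \<and> (succ3 i \<in> A \<longrightarrow> E (greedy_round A) (level_step i) = 0)"
    using assms
  proof (cases rule: move_set_cases)
    case 1
    then show ?thesis by (simp add: greedy_round_UNIV E_level_step_uniform)
  next
    case (2 j)
    show ?thesis unfolding 2 E_level_step_pair by (cases i; cases j) simp_all
  next
    case (3 j)
    show ?thesis unfolding 3 E_level_step_single by (cases i; cases j) simp_all
  qed
  then show "E (greedy_round A) (level_step i) \<ge> 0" by simp
  from * show "succ3 i \<in> A \<Longrightarrow> E (greedy_round A) (level_step i) = 0" by simp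
qed

section \<open>The unrestricted uniform game\<close>

lemma finite_play [simp]: "finite (set_pmf (play \<rho> \<nu> k))"
  by (induction k) auto

lemma E_play_Suc:
  "E (play \<rho> \<nu> (Suc k)) f = E (play \<rho> \<nu> k) (\<lambda>h. E (pair_pmf (\<rho> h) (\<nu> h)) (\<lambda>m. f (h @ [m])))"
  by (simp add: E_bind)

definition free_game :: "nat \<Rightarrow> history pmf" where
  "free_game = play (\<lambda>_. uniform_move) (\<lambda>_. uniform_move)"

lemma finite_free_game [simp]: "finite (set_pmf (free_game k))"
  by (simp add: free_game_def)

lemma E_free_game_0: "E (free_game 0) f = f []"
  by (simp add: free_game_def)

lemma E_free_game_Suc: "E (free_game (Suc k)) f
  = E (free_game k) (\<lambda>h. E uniform_round (\<lambda>m. f (h @ [m])))"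
  unfolding free_game_def E_play_Suc uniform_round_def ..

lemma free_game_counts:
  "E (free_game k) (\<lambda>g. f (count_move Rock g) (count_move Paper g) (count_move Scissors g))
    = tri_mean k f"
proof (induction k arbitrary: f)
  case (Suc k)
  show ?case
    using Suc[of "\<lambda>a b c. f (Suc a) b c"] Suc[of "\<lambda>a b c. f a (Suc b) c"] Suc[of "\<lambda>a b c. f a b (Suc c)"]
    by (simp add: E_free_game_Suc E_uniform_round E_uniform_move E_add)
qed (simp add: E_free_game_0)

text \<open>
  Given all moves of R, the score in each round has mean zero because N plays uniformly.
\<close>
lemma free_game_score_orthogonal: "E (free_game k) (\<lambda>g. real_of_int (score g) * \<phi> (map fst g)) = 0"
proof (induction k arbitrary: \<phi>)
  case (Suc k)
  have "E uniform_round (\<lambda>m. real_of_int (score (g @ [m])) * \<phi> (map fst (g @ [m])))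
      = real_of_int (score g) * E uniform_move (\<lambda>r. \<phi> (map fst g @ [r]))" for g
    unfolding E_uniform_round E_uniform_move
    by (simp add: score_snoc round_score_simp) (simp add: field_simps)
  then show ?case
    using Suc[of "\<lambda>l. E uniform_move (\<lambda>r. \<phi> (l @ [r]))"] by (simp only: E_free_game_Suc)
qed (simp add: E_free_game_0 score_def)

lemma free_game_score_sq: "E (free_game k) (\<lambda>g. real_of_int (score g) ^ 2) = 2 * real k / 3"
proof (induction k)
  case (Suc k)
  have "E uniform_round (\<lambda>m. real_of_int (score (g @ [m])) ^ 2)
    = real_of_int (score g) ^ 2 + 2 / 3" for g
    unfolding E_uniform_round E_uniform_move
    by (simp add: score_snoc round_score_simp power2_eq_square) (simp add: field_simps)
  then show ?case
    by (simp add: E_free_game_Suc Suc E_add)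
qed (simp add: E_free_game_0 score_def)

lemma free_game_count_variance: "E (free_game k) (\<lambda>g. (real (count_move i g) - real k / 3) ^ 2)
  = 2 * real k / 9"
proof (induction k)
  case (Suc k)
  have "E uniform_round (\<lambda>m. (real (count_move i (g @ [m])) - real (Suc k) / 3) ^ 2)
    = (real (count_move i g) - real k / 3) ^ 2 + 2 / 9" for g
    unfolding E_uniform_round E_uniform_move
    by (cases i) (simp_all add: power2_eq_square, simp_all add: field_simps)
  then show ?case
    by (simp add: E_free_game_Suc Suc E_add)
qed (simp add: E_free_game_0)

text \<open>
  Until the first exhaustion both coupled games are the same, so the event that the greedy
  game has lost a move can be bounded by this event of the uniform game.
\<close>
definition exhaustion_prob :: "nat \<Rightarrow> nat \<Rightarrow> real" where
  "exhaustion_prob n k = E (free_game k) (\<lambda>g. of_bool (\<exists>i. n \<le> count_move i g))"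

lemma exhaustion_prob_le_1: "exhaustion_prob n k \<le> 1"
proof -
  have "exhaustion_prob n k \<le> E (free_game k) (\<lambda>g. 1)"
    unfolding exhaustion_prob_def by (rule E_mono) auto
  then show ?thesis by simp
qed

text \<open>
  Chebyshev's inequality for each of the three counters, whose mean is \<open>k / 3\<close>.
\<close>
lemma exhaustion_prob_le:
  assumes "k < 3 * n"
  shows "exhaustion_prob n k \<le> 18 * real n / real (3 * n - k) ^ 2"
proof -
  define x where "x = real n - real k / 3"
  have x: "x > 0" using assms unfolding x_def by linarith
  have "exhaustion_prob n k
    \<le> E (free_game k) (\<lambda>g. \<Sum>i\<in>UNIV. (real (count_move i g) - real k / 3) ^ 2 / x ^ 2)"
    unfolding exhaustion_prob_def
  proof (rule E_mono)
    fix g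
    show "of_bool (\<exists>i. n \<le> count_move i g) \<le> (\<Sum>i\<in>UNIV. (real (count_move i g) - real k / 3) ^ 2 / x ^ 2)"
    proof (cases "\<exists>i. n \<le> count_move i g")
      case True
      then obtain i where i: "n \<le> count_move i g" by auto
      have "x ^ 2 \<le> (real (count_move i g) - real k / 3) ^ 2"
        using x i by (intro power_mono) (auto simp: x_def)
      then have "1 \<le> (real (count_move i g) - real k / 3) ^ 2 / x ^ 2"
        using x by simp
      also have "\<dots> \<le> (\<Sum>i\<in>UNIV. (real (count_move i g) - real k / 3) ^ 2 / x ^ 2)"
        by (rule member_le_sum[where f = "\<lambda>i. (real (count_move i g) - real k / 3) ^ 2 / x ^ 2"]) auto
      finally show ?thesis using True by simp
    qed (auto intro: sum_nonneg)
  qed simp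
  also have "\<dots> = (\<Sum>i\<in>(UNIV :: move set). 2 * real k / 9 / x ^ 2)"
    by (subst E_sum) (simp_all add: free_game_count_variance)
  also have "\<dots> = 6 * real k / (3 * x) ^ 2"
    by (simp only: sum_move power_mult_distrib) simp
  also have "3 * x = real (3 * n - k)" using assms by (simp add: of_nat_diff x_def)
  also have "6 * real k / real (3 * n - k) ^ 2 \<le> 18 * real n / real (3 * n - k) ^ 2"
    using assms by (intro divide_right_mono) auto
  finally show ?thesis .
qed

text \<open>
  Trivial bound for the last \<open>K\<close> rounds, Chebyshev for the others; any \<open>K\<close> of order strictly
  between \<open>sqrt n\<close> and \<open>n\<close> makes the sum \<open>o(n)\<close>.
\<close>
lemma exhaustion_prob_sum:
  assumes "K > 0"
  shows "(\<Sum>k<3 * n. exhaustion_prob n k) \<le> real K + 54 * real n ^ 2 / real K ^ 2"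
proof -
  have "(\<Sum>k<3 * n. exhaustion_prob n k) \<le> (\<Sum>k<3 * n. of_bool (3 * n - k \<le> K) + 18 * real n / real K ^ 2)"
  proof (rule sum_mono)
    fix k assume k: "k \<in> {..<3 * n}"
    show "exhaustion_prob n k \<le> of_bool (3 * n - k \<le> K) + 18 * real n / real K ^ 2"
    proof (cases "3 * n - k \<le> K")
      case True
      have "0 \<le> 18 * real n / real K ^ 2" by simp
      with exhaustion_prob_le_1[of n k] show ?thesis using True by (simp only: of_bool_eq)
    next
      case False
      have "exhaustion_prob n k \<le> 18 * real n / real (3 * n - k) ^ 2"
        using k by (intro exhaustion_prob_le) auto
      also have "\<dots> \<le> 18 * real n / real K ^ 2"
        using False assms by (intro divide_left_mono power_mono) auto
      finally show ?thesis using False by simp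
    qed
  qed
  also have "\<dots> = real (card {k \<in> {..<3 * n}. 3 * n - k \<le> K}) + 54 * real n ^ 2 / real K ^ 2"
    by (simp add: sum.distrib power2_eq_square Int_def)
  also have "card {k \<in> {..<3 * n}. 3 * n - k \<le> K} \<le> card ((\<lambda>m. 3 * n - m) ` {0<..K})"
    by (intro card_mono) (auto intro!: image_eqI[where x = "3 * n - x" for x])
  also have "\<dots> \<le> K" using card_image_le[of "{0<..K}"] by simp
  finally show ?thesis by simp
qed

section \<open>Coupling the greedy game with the uniform game\<close>

text \<open>
  The first component follows the greedy strategies and the second one plays uniformly. They
  share their moves as long as the greedy strategies are uniform, too.
\<close>
definition coupled_step :: "nat \<Rightarrow> history \<Rightarrow> history \<Rightarrow> (history \<times> history) pmf" where
  "coupled_step n h g =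
     (if available n h = UNIV then map_pmf (\<lambda>m. (h @ [m], g @ [m])) uniform_round
      else map_pmf (\<lambda>(m, m'). (h @ [m], g @ [m'])) (pair_pmf (greedy_round (available n h)) uniform_round))"

primrec coupled :: "nat \<Rightarrow> nat \<Rightarrow> (history \<times> history) pmf" where
  "coupled n 0 = return_pmf ([], [])"
| "coupled n (Suc k) = bind_pmf (coupled n k) (\<lambda>(h, g). coupled_step n h g)"

lemma finite_coupled_step [simp]: "finite (set_pmf (coupled_step n h g))"
  by (simp add: coupled_step_def)

lemma finite_coupled [simp]: "finite (set_pmf (coupled n k))"
  by (induction k) auto

lemma E_coupled_Suc: "E (coupled n (Suc k)) f = E (coupled n k) (\<lambda>(h, g). E (coupled_step n h g) f)"
  by (simp add: E_bind case_prod_unfold)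

lemma coupled_step_fst: "map_pmf fst (coupled_step n h g)
  = map_pmf (\<lambda>m. h @ [m]) (greedy_round (available n h))"
proof (cases "available n h = UNIV")
  case True
  then show ?thesis by (simp add: coupled_step_def greedy_round_UNIV map_pmf_comp)
next
  case False
  have "map_pmf fst (coupled_step n h g)
     = map_pmf (\<lambda>m. h @ [m]) (map_pmf fst (pair_pmf (greedy_round (available n h)) uniform_round))"
    using False by (simp add: coupled_step_def map_pmf_comp case_prod_unfold del: map_fst_pair_pmf)
  then show ?thesis by (simp add: map_fst_pair_pmf)
qed

lemma coupled_step_snd: "map_pmf snd (coupled_step n h g) = map_pmf (\<lambda>m. g @ [m]) uniform_round"
proof (cases "available n h = UNIV")
  case True
  then show ?thesis by (simp add: coupled_step_def map_pmf_comp)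
next
  case False
  have "map_pmf snd (coupled_step n h g)
     = map_pmf (\<lambda>m. g @ [m]) (map_pmf snd (pair_pmf (greedy_round (available n h)) uniform_round))"
    using False by (simp add: coupled_step_def map_pmf_comp case_prod_unfold del: map_snd_pair_pmf)
  then show ?thesis by (simp add: map_snd_pair_pmf)
qed

lemma coupled_fst: "map_pmf fst (coupled n k) = play (greedy_R n) (greedy_N n) k"
proof (induction k)
  case (Suc k)
  have "map_pmf fst (coupled n (Suc k))
      = bind_pmf (map_pmf fst (coupled n k)) (\<lambda>h. map_pmf (\<lambda>m. h @ [m]) (greedy_round (available n h)))"
    by (simp add: map_bind_pmf bind_map_pmf case_prod_unfold coupled_step_fst)
  then show ?case
    by (simp only: Suc) (simp add: greedy_round_def greedy_R_def greedy_N_def)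
qed simp

lemma coupled_snd: "map_pmf snd (coupled n k) = free_game k"
proof (induction k)
  case (Suc k)
  have "map_pmf snd (coupled n (Suc k))
      = bind_pmf (map_pmf snd (coupled n k)) (\<lambda>g. map_pmf (\<lambda>m. g @ [m]) uniform_round)"
    by (simp add: map_bind_pmf bind_map_pmf case_prod_unfold coupled_step_snd)
  then show ?case
    by (simp only: Suc) (simp add: free_game_def uniform_round_def)
qed (simp add: free_game_def)

lemma E_coupled_snd: "E (coupled n k) (\<lambda>x. f (snd x)) = E (free_game k) f"
  by (subst coupled_snd[of n k, symmetric]) simp

lemma available_snoc_subset: "available n (h @ [m]) \<subseteq> available n h"
  by (auto simp: available_eq)

lemma available_nonempty:
  assumes "length h < 3 * n"
  shows "available n h \<noteq> {}"
proof
  assume "available n h = {}"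
  then have "n \<le> count_move i h" for i
    by (auto simp: available_eq not_less)
  from this[of Rock] this[of Paper] this[of Scissors] show False
    using sum_count_move[of h] assms by simp
qed

lemma coupled_step_cases:
  assumes "x \<in> set_pmf (coupled_step n h g)"
  obtains m where "available n h = UNIV" "x = (h @ [m], g @ [m])"
  | m m' where "available n h \<noteq> UNIV" "x
  = (h @ [m], g @ [m'])" "m \<in> set_pmf (greedy_round (available n h))"
  using assms by (auto simp: coupled_step_def split: if_splits)

lemma coupled_invariant:
  assumes "(h, g) \<in> set_pmf (coupled n k)" "k \<le> 3 * n"
  shows "length h = k" and "count_move i h \<le> n" and "available n h = UNIV \<Longrightarrow> h = g"
    and "available n h \<noteq> UNIV \<Longrightarrow> \<exists>i. n \<le> count_move i g"
proof -
  have "length h = k \<and> (\<forall>i. count_move i h \<le> n) \<and> (available n h = UNIV \<longrightarrow> h = g)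
      \<and> (available n h \<noteq> UNIV \<longrightarrow> (\<exists>i. n \<le> count_move i g))"
    using assms
  proof (induction k arbitrary: h g)
    case 0
    then show ?case by (auto simp: available_eq)
  next
    case (Suc k)
    from Suc.prems obtain h0 g0 where 0: "(h0, g0) \<in> set_pmf (coupled n k)"
      and x: "(h, g) \<in> set_pmf (coupled_step n h0 g0)" by auto
    from Suc.IH[OF 0] Suc.prems have IH: "length h0 = k" "\<And>i. count_move i h0 \<le> n" "available n h0
      = UNIV \<Longrightarrow> h0 = g0"
      "available n h0 \<noteq> UNIV \<Longrightarrow> \<exists>i. n \<le> count_move i g0" by auto
    from x show ?case
    proof (cases rule: coupled_step_cases)
      case (1 m)
      then have "count_move i h0 < n" for i by (auto simp: available_eq set_eq_iff)
      then have "count_move i h \<le> n" for i using 1 by (auto simp: Suc_le_eq intro: less_imp_le)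
      moreover have "h = g" using 1 IH(3) by auto
      ultimately show ?thesis using 1 IH(1) by (auto simp: available_eq not_less)
    next
      case (2 m m')
      have "fst m \<in> set_pmf (greedy_R_move (available n h0))"
        using 2(3) by (auto simp: greedy_round_def)
      then have "fst m \<in> available n h0"
        using set_greedy_R_move[OF available_nonempty[of h0 n]] IH(1) Suc.prems by auto
      then have "count_move i h \<le> n" for i
        using 2 IH(2)[of i] by (auto simp: available_eq)
      moreover have "available n h \<noteq> UNIV"
        using 2 available_snoc_subset[of n h0 m] by auto
      moreover have "\<exists>i. n \<le> count_move i g"
      proof -
        obtain i where "n \<le> count_move i g0" using IH(4) 2 by auto
        then have "n \<le> count_move i g" using 2 by auto
        then show ?thesis ..
      qed
      ultimately show ?thesis using 2 IH(1) by auto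
    qed
  qed
  then show "length h = k" "count_move i h \<le> n" "available n h = UNIV \<Longrightarrow> h = g"
    "available n h \<noteq> UNIV \<Longrightarrow> \<exists>i. n \<le> count_move i g" by auto
qed

definition gap :: "move \<Rightarrow> history \<times> history \<Rightarrow> real" where
  "gap i x = level i (fst x) - level i (snd x)"

text \<open>
  The negative part of a gap is always counted, the full gap only while it is a martingale.
  Available moves are never regained, so the second term can only be switched off.
\<close>
definition potential_at :: "nat \<Rightarrow> move \<Rightarrow> history \<times> history \<Rightarrow> real" where
  "potential_at n i x = min (gap i x) 0 ^ 2 + of_bool (succ3 i \<in> available n (fst x)) * gap i x ^ 2"

definition potential :: "nat \<Rightarrow> history \<times> history \<Rightarrow> real" where
  "potential n x = (\<Sum>i\<in>UNIV. potential_at n i x)"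

lemma gap_snoc: "gap i (h @ [m], g @ [m']) = gap i (h, g) + (level_step i m - level_step i m')"
  by (simp add: gap_def level_snoc)

text \<open>
  The function \<open>x \<mapsto> min x 0 ^ 2\<close> is convex and lies below its tangents plus \<open>d ^ 2\<close>.
  Its derivative is nonpositive, so a step of nonnegative mean increases its expectation by at
  most the mean of \<open>d ^ 2\<close>.
\<close>
lemma min_sq_step:
  fixes x d :: real
  assumes "\<bar>d\<bar> \<le> 4"
  shows "min (x + d) 0 ^ 2 \<le> min x 0 ^ 2 + 2 * min x 0 * d + 16"
proof -
  have d: "d ^ 2 \<le> 16" using power_mono[OF assms, of 2] by simp
  show ?thesis
  proof (cases "x \<ge> 0")
    case True
    then have "\<bar>min (x + d) 0\<bar> \<le> \<bar>d\<bar>" by auto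
    from power_mono[OF this, of 2] show ?thesis using True d by simp
  next
    case False
    then have "\<bar>min (x + d) 0\<bar> \<le> \<bar>x + d\<bar>" by auto
    from power_mono[OF this, of 2] have "min (x + d) 0 ^ 2 \<le> (x + d) ^ 2" by simp
    also have "\<dots> \<le> x ^ 2 + 2 * x * d + 16" using d by (simp add: power2_sum)
    finally show ?thesis using False by simp
  qed
qed

text \<open>
  Both terms of the potential grow by a linear term of mean at most zero and by at most 16, the
  square of the largest change of a gap.
\<close>
lemma potential_at_step:
  assumes "available n h \<noteq> {}" "available n h \<noteq> UNIV"
  shows "E (coupled_step n h g) (potential_at n i) \<le> potential_at n i (h, g) + 32"
proof -
  define A where "A = available n h"
  define x where "x = gap i (h, g)"
  define c where "c = 2 * min x 0 + of_bool (succ3 i \<in> A) * (2 * x)"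
  define P where "P = pair_pmf (greedy_round A) uniform_round"
  have drift: "c * E (greedy_round A) (level_step i) \<le> 0"
    using E_level_step_greedy[of A i] assms
    by (auto simp: c_def A_def intro!: mult_nonpos_nonneg)
  have "E (coupled_step n h g) (potential_at n i)
      = E P (\<lambda>(m, m'). potential_at n i (h @ [m], g @ [m']))"
    using assms(2) by (simp add: coupled_step_def P_def A_def case_prod_unfold)
  also have "\<dots> \<le> E P (\<lambda>(m, m'). potential_at n i (h, g) + 32 + c * (level_step i m - level_step i m'))"
  proof (rule E_mono)
    fix y :: "(move \<times> move) \<times> (move \<times> move)"
    obtain m m' where y: "y = (m, m')" by (cases y)
    define d where "d = level_step i m - level_step i m'"
    have "\<bar>d\<bar> \<le> 4" using abs_level_step[of i m] abs_level_step[of i m'] by (simp add: d_def)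
    note sq = min_sq_step[OF this, of x]
    have "d ^ 2 \<le> 16" using power_mono[OF \<open>\<bar>d\<bar> \<le> 4\<close>, of 2] by simp
    moreover have "0 \<le> x ^ 2 + 2 * x * d + d ^ 2"
      using zero_le_power2[of "x + d"] unfolding power2_sum by linarith
    ultimately have "of_bool (succ3 i \<in> available n (h @ [m])) * (x + d) ^ 2
      \<le> of_bool (succ3 i \<in> A) * (x ^ 2 + 2 * x * d) + 16"
      using available_snoc_subset[of n h m] by (auto simp: A_def power2_sum)
    with sq have "potential_at n i (h @ [m], g @ [m']) \<le> potential_at n i (h, g) + 32 + c * d"
      by (simp add: potential_at_def gap_snoc c_def algebra_simps flip: x_def d_def A_def)
    then show "(case y of (m, m') \<Rightarrow> potential_at n i (h @ [m], g @ [m']))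
        \<le> (case y of (m, m') \<Rightarrow> potential_at n i (h, g) + 32 + c * (level_step i m - level_step i m'))"
      by (simp add: y d_def)
  qed (simp add: P_def)
  also have "\<dots> = potential_at n i (h, g) + 32
    + c * (E (greedy_round A) (level_step i) - E uniform_round (level_step i))"
    unfolding P_def by (subst E_pair) (simp_all add: E_add E_diff)
  also have "\<dots> \<le> potential_at n i (h, g) + 32"
    using drift by (simp add: E_level_step_uniform)
  finally show ?thesis .
qed

lemma potential_step:
  assumes "available n h \<noteq> {}"
  shows "E (coupled_step n h g) (potential n) \<le> potential n (h, g) + 96 * of_bool (available n h \<noteq> UNIV)"
proof (cases "available n h = UNIV")
  case True
  have "E (coupled_step n h g) (potential n) \<le> E (coupled_step n h g) (\<lambda>_. potential n (h, g))"
  proof (rule E_mono)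
    fix x assume "x \<in> set_pmf (coupled_step n h g)"
    then show "potential n x \<le> potential n (h, g)"
      using True by (cases rule: coupled_step_cases)
        (auto simp: potential_def potential_at_def gap_snoc intro!: sum_mono)
  qed simp
  then show ?thesis using True by simp
next
  case False
  have "E (coupled_step n h g) (potential n) = (\<Sum>i\<in>UNIV. E (coupled_step n h g) (potential_at n i))"
    unfolding potential_def by (rule E_sum) simp
  also have "\<dots> \<le> (\<Sum>i\<in>UNIV. potential_at n i (h, g) + 32)"
    by (intro sum_mono potential_at_step assms False)
  also have "\<dots> = potential n (h, g) + 96"
    by (simp add: potential_def sum_move)
  finally show ?thesis using False by simp
qed

lemma potential_bound:
  "k \<le> 3 * n \<Longrightarrow> E (coupled n k) (potential n) \<le> 96 * (\<Sum>j<k. exhaustion_prob n j)"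
proof (induction k)
  case 0
  then show ?case by (simp add: potential_def potential_at_def gap_def)
next
  case (Suc k)
  have "E (coupled n (Suc k)) (potential n)
     \<le> E (coupled n k) (\<lambda>x. potential n x + 96 * of_bool (\<exists>i. n \<le> count_move i (snd x)))"
    unfolding E_coupled_Suc
  proof (rule E_mono)
    fix x assume x: "x \<in> set_pmf (coupled n k)"
    obtain h g where hg: "x = (h, g)" by force
    note inv = coupled_invariant[of h g n k]
    have "available n h \<noteq> {}"
      using inv(1) x hg Suc.prems by (intro available_nonempty) auto
    from potential_step[OF this, of g]
    have "E (coupled_step n h g) (potential n)
      \<le> potential n (h, g) + 96 * of_bool (available n h \<noteq> UNIV)" .
    also have "of_bool (available n h \<noteq> UNIV) \<le> (of_bool (\<exists>i. n \<le> count_move i g) :: real)"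
      using inv(4) x hg Suc.prems by auto
    finally show "(case x of (h, g) \<Rightarrow> E (coupled_step n h g) (potential n))
        \<le> potential n x + 96 * of_bool (\<exists>i. n \<le> count_move i (snd x))" by (simp add: hg)
  qed simp
  also have "\<dots> = E (coupled n k) (potential n) + 96 * exhaustion_prob n k"
    unfolding exhaustion_prob_def E_coupled_snd[symmetric, where n = n] by (simp add: E_add)
  finally show ?case using Suc by simp
qed

definition min_gap :: "history \<times> history \<Rightarrow> real" where
  "min_gap x = min (gap Rock x) (min (gap Paper x) (gap Scissors x))"

text \<open>
  If the minimal gap is negative, its own negative part is counted. If it is positive, it is at
  most the gap of the predecessor of an available move, which is counted in full.
\<close>
lemma min_gap_sq_le_potential:
  assumes "available n (fst x) \<noteq> {}"
  shows "min_gap x ^ 2 \<le> potential n x"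
proof -
  have le: "potential_at n i x \<le> potential n x" for i
    unfolding potential_def by (rule member_le_sum) (auto simp: potential_at_def)
  show ?thesis
  proof (cases "min_gap x \<le> 0")
    case True
    obtain i where i: "min_gap x = gap i x"
      unfolding min_gap_def by (metis min_def)
    have "min_gap x ^ 2 \<le> potential_at n i x"
      using True i by (simp add: potential_at_def)
    with le[of i] show ?thesis by linarith
  next
    case False
    obtain j where "j \<in> available n (fst x)" using assms by auto
    moreover obtain i where "succ3 i = j" using succ3.simps by (cases j) blast+
    ultimately have i: "succ3 i \<in> available n (fst x)" by simp
    have "min_gap x \<le> gap i x" by (cases i) (simp_all add: min_gap_def)
    then have "min_gap x ^ 2 \<le> gap i x ^ 2" using False by (intro power_mono) auto
    also have "\<dots> \<le> potential_at n i x" using i by (simp add: potential_at_def)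
    finally show ?thesis using le[of i] by linarith
  qed
qed

lemma min_gap_step:
  assumes "x \<in> set_pmf (coupled_step n h g)"
  shows "min_gap x ^ 2 \<le> 2 * min_gap (h, g) ^ 2 + 32"
proof -
  obtain m m' where x: "x = (h @ [m], g @ [m'])"
    using assms by (cases rule: coupled_step_cases) auto
  have "\<bar>gap i x - gap i (h, g)\<bar> \<le> 4" for i
    using abs_level_step[of i m] abs_level_step[of i m'] by (simp add: x gap_snoc)
  from this[of Rock] this[of Paper] this[of Scissors]
  have "\<bar>min_gap x - min_gap (h, g)\<bar> \<le> 4"
    unfolding min_gap_def by linarith
  from power_mono[OF this, of 2] have d: "(min_gap x - min_gap (h, g)) ^ 2 \<le> 16" by simp
  have "a ^ 2 \<le> 2 * b ^ 2 + 2 * (a - b) ^ 2" for a b :: real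
  proof -
    have "0 \<le> (a - 2 * b) ^ 2" by simp
    then show ?thesis by (simp add: power2_eq_square algebra_simps)
  qed
  from this[of "min_gap x" "min_gap (h, g)"] d show ?thesis by linarith
qed

definition top_level :: "history \<Rightarrow> real" where
  "top_level g = real_of_int (score g)
    + top_lead (count_move Rock g) (count_move Paper g) (count_move Scissors g)"

text \<open>
  After \<open>3 * n\<close> rounds all leads of the greedy game vanish, so that each of its levels is the
  final score, whereas the largest level of the uniform game is \<open>top_level\<close>.
\<close>
lemma score_minus_top_level:
  assumes "(h, g) \<in> set_pmf (coupled n (3 * n))"
  shows "real_of_int (score h) - top_level g = min_gap (h, g)"
proof -
  have len: "length h = 3 * n" and le: "count_move i h \<le> n" for i
    using coupled_invariant[OF assms] by auto
  have "count_move i h = n" for i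
    using sum_count_move[of h] le[of Rock] le[of Paper] le[of Scissors] len by (cases i) simp_all
  then have "gap i (h, g) = real_of_int (score h) - level i g" for i
    by (simp add: gap_def level_def)
  then show ?thesis
    by (simp add: min_gap_def top_level_def top_lead_def level_def)
qed

text \<open>
  After the last round no move is available and the potential no longer bounds the minimal
  gap. Therefore the potential is used one round earlier, and the last round is paid for
  by the constant 32.
\<close>
lemma coupling_error:
  assumes "n > 0"
  shows "E (coupled n (3 * n)) (\<lambda>x. (real_of_int (score (fst x)) - top_level (snd x)) ^ 2)
    \<le> 192 * (\<Sum>j<3 * n. exhaustion_prob n j) + 32"
proof -
  obtain k where k: "3 * n = Suc k" using assms by (cases n) auto
  have pos: "exhaustion_prob n k \<ge> 0"
    unfolding exhaustion_prob_def by (rule integral_nonneg_AE) auto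
  have "E (coupled n (3 * n)) (\<lambda>x. (real_of_int (score (fst x)) - top_level (snd x)) ^ 2)
      = E (coupled n (Suc k)) (\<lambda>x. min_gap x ^ 2)"
    unfolding k[symmetric] by (rule E_cong) (auto simp: score_minus_top_level)
  also have "\<dots> \<le> E (coupled n k) (\<lambda>x. 2 * potential n x + 32)"
    unfolding E_coupled_Suc
  proof (rule E_mono)
    fix x assume x: "x \<in> set_pmf (coupled n k)"
    obtain h g where hg: "x = (h, g)" by force
    have "available n h \<noteq> {}"
      using coupled_invariant(1)[of h g n k] x hg k by (intro available_nonempty) auto
    then have "min_gap (h, g) ^ 2 \<le> potential n (h, g)" by (intro min_gap_sq_le_potential) auto
    have "E (coupled_step n h g) (\<lambda>x. min_gap x ^ 2)
      \<le> E (coupled_step n h g) (\<lambda>_. 2 * min_gap (h, g) ^ 2 + 32)"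
      by (rule E_mono) (auto intro: min_gap_step)
    also have "\<dots> \<le> 2 * potential n (h, g) + 32"
      using \<open>min_gap (h, g) ^ 2 \<le> potential n (h, g)\<close> by simp
    finally show "(case x of (h, g) \<Rightarrow> E (coupled_step n h g) (\<lambda>x. min_gap x ^ 2))
      \<le> 2 * potential n x + 32"
      by (simp add: hg)
  qed simp
  also have "\<dots> = 2 * E (coupled n k) (potential n) + 32"
    by (simp add: E_add)
  also have "\<dots> \<le> 2 * (96 * (\<Sum>j<k. exhaustion_prob n j)) + 32"
    using potential_bound[of k n] k by simp
  also have "\<dots> \<le> 192 * (\<Sum>j<3 * n. exhaustion_prob n j) + 32"
    using pos by (simp add: k)
  finally show ?thesis .
qed

section \<open>Asymptotics of the variance\<close>

lemma top_level_mean: "E (free_game (3 * n)) top_level = tri_mean (3 * n) top_lead"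
  using free_game_score_orthogonal[of "3 * n" "\<lambda>_. 1"] free_game_counts[of "3 * n" top_lead]
  unfolding top_level_def[abs_def] by (simp add: E_add)

lemma top_level_sq_mean:
  "E (free_game (3 * n)) (\<lambda>g. top_level g ^ 2)
    = 2 * real n + tri_mean (3 * n) (\<lambda>a b c. top_lead a b c ^ 2)"
proof -
  define \<phi> :: "move list \<Rightarrow> real" where
    "\<phi> = (\<lambda>l. 2 * top_lead (count_list l Rock) (count_list l Paper) (count_list l Scissors))"
  have "top_level g ^ 2 = real_of_int (score g) ^ 2 + real_of_int (score g) * \<phi> (map fst g)
      + top_lead (count_move Rock g) (count_move Paper g) (count_move Scissors g) ^ 2" for g
    by (simp add: top_level_def \<phi>_def count_move_def power2_sum)
  then show ?thesis
    using free_game_counts[of "3 * n" "\<lambda>a b c. top_lead a b c ^ 2"]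
    by (simp add: E_add free_game_score_orthogonal free_game_score_sq)
qed

abbreviation Var :: "'a pmf \<Rightarrow> ('a \<Rightarrow> real) \<Rightarrow> real" where
  "Var p f \<equiv> measure_pmf.variance p f"

lemma Var_eq: "finite (set_pmf p) \<Longrightarrow> Var p f = E p (\<lambda>x. f x ^ 2) - (E p f) ^ 2"
  by (rule measure_pmf.variance_eq) (auto intro: integrable_measure_pmf_finite)

text \<open>
  Young's inequality \<open>2 * \<bar>y * d\<bar> \<le> t * y\<^sup>2 + d\<^sup>2 / t\<close> applied to the covariance.
\<close>
lemma Var_perturb:
  assumes "finite (set_pmf p)" "t > 0" "E p (\<lambda>x. (f x - g x) ^ 2) \<le> e"
  shows "\<bar>Var p f - Var p g\<bar> \<le> t * Var p g + (1 + 1 / t) * e"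
proof -
  define y where "y x = g x - E p g" for x
  define d where "d x = (f x - g x) - E p (\<lambda>x. f x - g x)" for x
  have "E p (\<lambda>x. d x ^ 2) = E p (\<lambda>x. (f x - g x) ^ 2) - (E p (\<lambda>x. f x - g x)) ^ 2"
    unfolding d_def by (rule Var_eq) (rule assms)
  also have "\<dots> \<le> E p (\<lambda>x. (f x - g x) ^ 2)" by simp
  finally have d: "E p (\<lambda>x. d x ^ 2) \<le> e" using assms(3) by simp
  have fy: "f x - E p f = y x + d x" for x
    using assms(1) by (simp add: y_def d_def E_diff)
  have "Var p f - Var p g = E p (\<lambda>x. 2 * y x * d x + d x ^ 2)"
    unfolding fy unfolding y_def[symmetric] E_diff[OF assms(1), symmetric]
      by (simp add: power2_sum algebra_simps)
  also have "\<bar>\<dots>\<bar> \<le> E p (\<lambda>x. \<bar>2 * y x * d x + d x ^ 2\<bar>)"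
    by (rule integral_abs_bound)
  also have "\<dots> \<le> E p (\<lambda>x. t * y x ^ 2 + (1 + 1 / t) * d x ^ 2)"
  proof (rule E_mono[OF assms(1)])
    fix x
    have "0 \<le> (t * y x - d x) ^ 2 / t" "0 \<le> (t * y x + d x) ^ 2 / t" using assms(2) by auto
    then have "\<bar>2 * y x * d x\<bar> \<le> t * y x ^ 2 + 1 / t * d x ^ 2"
      using assms(2) by (auto simp: power2_eq_square field_simps abs_le_iff)
    then show "\<bar>2 * y x * d x + d x ^ 2\<bar> \<le> t * y x ^ 2 + (1 + 1 / t) * d x ^ 2"
      using abs_triangle_ineq[of "2 * y x * d x" "d x ^ 2"] by (simp add: distrib_right)
  qed
  also have "\<dots> = t * Var p g + (1 + 1 / t) * E p (\<lambda>x. d x ^ 2)"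
    using assms(1) by (simp add: E_add y_def)
  also have "\<dots> \<le> t * Var p g + (1 + 1 / t) * e"
    using d assms(2) by (intro add_left_mono mult_left_mono) auto
  finally show ?thesis .
qed

definition limit_const :: real where
  "limit_const = 4 - (27 - 6 * sqrt 3) / (4 * pi)"

lemma limit_const_pos: "limit_const > 0"
proof -
  have "(27 - 6 * sqrt 3) / (4 * pi) \<le> 27 / (4 * 3)"
    using pi_gt3 by (intro frac_le) auto
  also have "\<dots> < 4" by simp
  finally show ?thesis by (simp only: limit_const_def diff_gt_0_iff_gt)
qed

lemma top_level_variance_asymp:
  "(\<lambda>n. Var (free_game (3 * n)) top_level / real n) \<longlonglongrightarrow> limit_const"
proof -
  let ?m1 = "\<lambda>n. tri_mean (3 * n) top_lead / sqrt (real n)"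
  let ?m2 = "\<lambda>n. tri_mean (3 * n) (\<lambda>a b c. top_lead a b c ^ 2) / real n"
  have "(\<lambda>n. 2 + ?m2 n - ?m1 n ^ 2) \<longlonglongrightarrow> 2 + (2 + 3 * sqrt 3 / (2 * pi)) - (3 * sqrt 3 / (2 * sqrt pi)) ^ 2"
    by (intro tendsto_intros top_lead_mean_asymp top_lead_sq_asymp)
  also have "2 + (2 + 3 * sqrt 3 / (2 * pi)) - (3 * sqrt 3 / (2 * sqrt pi)) ^ 2 = limit_const"
    by (simp add: limit_const_def power_divide power_mult_distrib field_simps)
  finally have "(\<lambda>n. 2 + ?m2 n - ?m1 n ^ 2) \<longlonglongrightarrow> limit_const" .
  moreover have "eventually (\<lambda>n. 2 + ?m2 n - ?m1 n ^ 2
    = Var (free_game (3 * n)) top_level / real n) at_top"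
    using eventually_gt_at_top[of 0]
    by eventually_elim
      (subst Var_eq, simp_all add: top_level_mean top_level_sq_mean power_divide diff_divide_distrib add_divide_distrib)
  ultimately show ?thesis by (simp add: tendsto_cong)
qed

lemma greedy_variance_perturb:
  assumes "n > 0" "K > 0" "t > 0"
  shows "\<bar>Var (greedy_game n) (\<lambda>h. real_of_int (score h)) - Var (free_game (3 * n)) top_level\<bar>
    \<le> t * Var (free_game (3 * n)) top_level
      + (1 + 1 / t) * (192 * (real K + 54 * real n ^ 2 / real K ^ 2) + 32)"
proof -
  let ?p = "coupled n (3 * n)"
  have "E ?p (\<lambda>x. (real_of_int (score (fst x)) - top_level (snd x)) ^ 2)
    \<le> 192 * (real K + 54 * real n ^ 2 / real K ^ 2) + 32"
    by (rule order_trans[OF coupling_error[OF assms(1)]])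
      (intro add_right_mono mult_left_mono exhaustion_prob_sum assms, simp)
  from Var_perturb[OF _ assms(3) this]
  have "\<bar>Var ?p (\<lambda>x. real_of_int (score (fst x))) - Var ?p (\<lambda>x. top_level (snd x))\<bar>
    \<le> t * Var ?p (\<lambda>x. top_level (snd x))
      + (1 + 1 / t) * (192 * (real K + 54 * real n ^ 2 / real K ^ 2) + 32)"
    by simp
  moreover have "Var ?p (\<lambda>x. top_level (snd x)) = Var (free_game (3 * n)) top_level"
    unfolding coupled_snd[of n, symmetric] by simp
  moreover have "Var ?p (\<lambda>x. real_of_int (score (fst x)))
    = Var (greedy_game n) (\<lambda>h. real_of_int (score h))"
    unfolding greedy_game_def coupled_fst[symmetric] by simp
  ultimately show ?thesis by simp
qed

theorem mainTheorem4:
  shows "(\<lambda>n::nat. measure_pmf.variance (greedy_game n) (\<lambda>h. real_of_int (score h)))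
           \<sim>[at_top] (\<lambda>n. (4 - (27 - 6 * sqrt 3) / (4 * pi)) * real n)"
proof -
  define V where "V n = Var (greedy_game n) (\<lambda>h. real_of_int (score h))" for n
  define W where "W n = Var (free_game (3 * n)) top_level" for n
  \<comment> \<open>The error \<open>K + n\<^sup>2 / K\<^sup>2\<close> is of order \<open>n powr (3/4)\<close>, small enough
    that the factor \<open>1 / t\<close> keeps it \<open>o(n)\<close>.\<close>
  define K where "K n = nat \<lceil>real n powr (3/4)\<rceil>" for n
  define t where "t n = real n powr (-1/10)" for n :: nat
  define e where "e n
    = (1 + 1 / t n) * ((192 * ((real n powr (3/4) + 1) + 54 * real n ^ 2 / (real n powr (3/4)) ^ 2)
      + 32) / real n)" for n
  have W: "(\<lambda>n. W n / real n) \<longlonglongrightarrow> limit_const"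
    unfolding W_def by (rule top_level_variance_asymp)
  have t: "t \<longlonglongrightarrow> 0" unfolding t_def by real_asymp
  have e: "e \<longlonglongrightarrow> 0" unfolding e_def t_def by real_asymp
  have "(\<lambda>n. V n / real n - W n / real n) \<longlonglongrightarrow> 0"
  proof (rule Lim_null_comparison)
    have "(\<lambda>n. t n * (W n / real n) + e n) \<longlonglongrightarrow> 0 * limit_const + 0"
      by (intro tendsto_intros t e W)
    then show "(\<lambda>n. t n * (W n / real n) + e n) \<longlonglongrightarrow> 0" by simp
    show "eventually (\<lambda>n. norm (V n / real n - W n / real n) \<le> t n * (W n / real n) + e n) at_top"
      using eventually_gt_at_top[of 0]
    proof eventually_elim
      case (elim n)
      have P: "real n powr (3/4) > 0" using elim by simp
      have K: "real n powr (3/4) \<le> real (K n)" "real (K n) \<le> real n powr (3/4) + 1"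
        unfolding K_def using P by linarith+
      then have K0: "K n > 0" using P by linarith
      have t0: "t n > 0" using elim by (simp add: t_def)
      have "\<bar>V n - W n\<bar>
        \<le> t n * W n + (1 + 1 / t n) * (192 * (real (K n) + 54 * real n ^ 2 / real (K n) ^ 2) + 32)"
        unfolding V_def W_def by (rule greedy_variance_perturb[OF elim K0 t0])
      also have "\<dots> \<le> t n * W n
        + (1 + 1 / t n)
          * (192 * ((real n powr (3/4) + 1) + 54 * real n ^ 2 / (real n powr (3/4)) ^ 2) + 32)"
      proof (intro add_left_mono mult_left_mono add_mono divide_left_mono power_mono)
        show "0 < real (K n) ^ 2 * (real n powr (3/4)) ^ 2"
          using K0 P by (intro mult_pos_pos zero_less_power) simp_all
      qed (use K P t0 in auto)
      finally have "\<bar>V n - W n\<bar> / real n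
        \<le> (t n * W n + (1 + 1 / t n)
          * (192 * ((real n powr (3/4) + 1) + 54 * real n ^ 2 / (real n powr (3/4)) ^ 2) + 32)) / real n"
        by (rule divide_right_mono) simp
      also have "\<dots> = t n * (W n / real n) + e n"
        unfolding e_def by (simp only: add_divide_distrib[of "t n * W n"] times_divide_eq_right)
      finally show ?case by (simp flip: diff_divide_distrib)
    qed
  qed
  from tendsto_add[OF this W] have "(\<lambda>n. V n / real n) \<longlonglongrightarrow> limit_const" by simp
  from tendsto_divide[OF this tendsto_const[of limit_const]]
  have "(\<lambda>n. V n / real n / limit_const) \<longlonglongrightarrow> 1"
    using limit_const_pos by simp
  then have "(\<lambda>n. V n / (limit_const * real n)) \<longlonglongrightarrow> 1"
    by (simp add: divide_divide_eq_left mult.commute)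
  then have "V \<sim>[at_top] (\<lambda>n. limit_const * real n)"
    by (rule asymp_equivI')
  then show ?thesis
    unfolding V_def limit_const_def .
qed

end
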